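(* Let $\alpha>0$, let $\mathbb{V}$ be a complex Hilbert space, and let $f\in L^2(\mathbb{R}_+,\mathbb{V},\alpha)$. Then $$\|f\|_{L^2(\mathbb{R}_+,\mathbb{V},\alpha)}=\frac{1}{\sqrt{2\pi}}\,\big\|\mathcal{L}\{f\}\big\|_{H^2(\mathbb{C}_\alpha,\mathbb{V})}.$$
   Context: $\mathbb{R}_+=\{t\in\mathbb{R}:t>0\}$. For $\alpha>0$, $L^2(\mathbb{R}_+,\mathbb{V},\alpha)$ is the Hilbert space of (strongly) measurable functions $u:\mathbb{R}_+\to\mathbb{V}$ (modulo equality almost everywhere) with $\|u\|_{L^2(\mathbb{R}_+,\mathbb{V},\alpha)}=\left(\int_0^\infty \|u(t)\|_{\mathbb{V}}^2\,e^{-2\alpha t}\,dt\right)^{1/2}<\infty$. $\mathbb{C}_\alpha=\{s\in\mathbb{C}:\operatorname{Re}(s)>\alpha\}$. The Laplace transform of $f$ is $\mathcal{L}\{f\}(s)=\int_0^\infty e^{-st}f(t)\,dt$ (a Bochner integral), for $s\in\mathbb{C}_\alpha$. $H^2(\mathbb{C}_\alpha,\mathbb{V})$ is the Hardy space of holomorphic functions $F:\mathbb{C}_\alpha\to\mathbb{V}$ with $$\|F\|_{H^2(\mathbb{C}_\alpha,\mathbb{V})}=\sup_{\sigma>\alpha}\left(\int_{-\infty}^{\infty}\|F(\sigma+i\tau)\|_{\mathbb{V}}^2\,d\tau\right)^{1/2}<\infty.$$ *)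

theory Defs
  imports "HOL-Complex_Analysis.Complex_Analysis"
begin

class complex_vector = real_vector +
  fixes scaleC :: "complex \<Rightarrow> 'a \<Rightarrow> 'a" (infixr "*\<^sub>C" 75)
  assumes scaleC_add_right: "a *\<^sub>C (x + y) = a *\<^sub>C x + a *\<^sub>C y"
    and scaleC_add_left: "(a + b) *\<^sub>C x = a *\<^sub>C x + b *\<^sub>C x"
    and scaleC_scaleC: "a *\<^sub>C b *\<^sub>C x = (a * b) *\<^sub>C x"
    and scaleC_of_real: "complex_of_real r *\<^sub>C x = r *\<^sub>R x"

(* The inner product is linear in the first argument. Positive definiteness follows from
   cinner_norm and the norm axioms. *)
class complex_inner = complex_vector + real_normed_vector +
  fixes cinner :: "'a \<Rightarrow> 'a \<Rightarrow> complex"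
  assumes cinner_commute: "cinner x y = cnj (cinner y x)"
    and cinner_add_left: "cinner (x + y) z = cinner x z + cinner y z"
    and cinner_scaleC_left: "cinner (a *\<^sub>C x) y = a * cinner x y"
    and cinner_norm: "norm x = sqrt (Re (cinner x x))"

class chilbert_space = complex_inner + banach

instantiation complex :: chilbert_space
begin

definition scaleC_complex :: "complex \<Rightarrow> complex \<Rightarrow> complex"
  where "scaleC_complex a x = a * x"

definition cinner_complex :: "complex \<Rightarrow> complex \<Rightarrow> complex"
  where "cinner_complex x y = x * cnj y"

instance
proof
  fix x :: complex
  show "norm x = sqrt (Re (cinner x x))"
    by (simp add: cinner_complex_def cmod_def power2_eq_square)
qed (auto simp: scaleC_complex_def cinner_complex_def algebra_simps scaleR_conv_of_real)

end

definition strongly_measurable :: "'a measure \<Rightarrow> ('a \<Rightarrow> 'b::topological_space) \<Rightarrow> bool"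
  where "strongly_measurable M f \<longleftrightarrow>
    (\<exists>s. (\<forall>i. simple_function M (s i)) \<and> (AE t in M. (\<lambda>i. s i t) \<longlonglongrightarrow> f t))"

(* The library's has_bochner_integral and lebesgue_integral are confined to second countable
   (separable) codomains. The following is the Bochner integral for an arbitrary normed
   codomain; has_strong_integral_iff shows that it agrees with the library in the separable case. *)
definition has_strong_integral ::
    "'a measure \<Rightarrow> ('a \<Rightarrow> 'b::real_normed_vector) \<Rightarrow> 'b \<Rightarrow> bool"
  where "has_strong_integral M f x \<longleftrightarrow> strongly_measurable M f \<and>
    (\<exists>s. (\<forall>i. Bochner_Integration.simple_bochner_integrable M (s i)) \<and>
      (\<lambda>i. \<integral>\<^sup>+t. ennreal (norm (f t - s i t)) \<partial>M) \<longlonglongrightarrow> 0 \<and>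
      (\<lambda>i. Bochner_Integration.simple_bochner_integral M (s i)) \<longlonglongrightarrow> x)"

definition strong_integral :: "'a measure \<Rightarrow> ('a \<Rightarrow> 'b::real_normed_vector) \<Rightarrow> 'b"
  where "strong_integral M f =
    (if \<exists>x. has_strong_integral M f x then THE x. has_strong_integral M f x else 0)"

lemma strongly_measurable_borel:
  fixes f :: "'a \<Rightarrow> 'b::{second_countable_topology, real_normed_vector}"
  assumes "f \<in> borel_measurable M"
  shows "strongly_measurable M f"
proof -
  obtain s where "\<And>i. simple_function M (s i)"
    and "\<And>x. x \<in> space M \<Longrightarrow> (\<lambda>i. s i x) \<longlonglongrightarrow> f x"
    using borel_measurable_implies_sequence_metric[OF assms, of 0] by blast
  then show ?thesis
    unfolding strongly_measurable_def by (intro exI[of _ s]) auto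
qed

lemma has_strong_integral_iff:
  fixes f :: "'a \<Rightarrow> 'b::{second_countable_topology, real_normed_vector}"
  assumes "f \<in> borel_measurable M"
  shows "has_strong_integral M f x \<longleftrightarrow> has_bochner_integral M f x"
  using assms strongly_measurable_borel[OF assms]
  unfolding has_strong_integral_def has_bochner_integral.simps by auto

definition weighted_L2 :: "real \<Rightarrow> (real \<Rightarrow> 'v::real_normed_vector) set"
  where "weighted_L2 \<alpha> = {u. strongly_measurable (lebesgue_on {0<..}) u \<and>
    integrable (lebesgue_on {0<..}) (\<lambda>t. (norm (u t))\<^sup>2 * exp (- 2 * \<alpha> * t))}"

definition weighted_L2_norm :: "real \<Rightarrow> (real \<Rightarrow> 'v::real_normed_vector) \<Rightarrow> real"
  where "weighted_L2_norm \<alpha> u =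
    sqrt (LINT t|lebesgue_on {0<..}. (norm (u t))\<^sup>2 * exp (- 2 * \<alpha> * t))"

definition laplace_transform :: "(real \<Rightarrow> 'v::chilbert_space) \<Rightarrow> complex \<Rightarrow> 'v"
  where "laplace_transform f s =
    strong_integral (lebesgue_on {0<..}) (\<lambda>t. exp (- s * complex_of_real t) *\<^sub>C f t)"

(* The library's holomorphic_on only covers complex-valued functions. *)
definition vector_holomorphic_on :: "(complex \<Rightarrow> 'v::complex_inner) \<Rightarrow> complex set \<Rightarrow> bool"
  where "vector_holomorphic_on F S \<longleftrightarrow>
    (\<forall>s\<in>S. \<exists>D. ((\<lambda>w. (1 / (w - s)) *\<^sub>C (F w - F s)) \<longlongrightarrow> D) (at s within S))"

lemma vector_holomorphic_on_complex:
  fixes F :: "complex \<Rightarrow> complex"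
  shows "vector_holomorphic_on F S \<longleftrightarrow> F holomorphic_on S"
  by (simp add: vector_holomorphic_on_def holomorphic_on_def field_differentiable_def
      has_field_derivative_iff scaleC_complex_def)

(* Elements of the Hardy space are represented by functions on the whole complex plane, of which
   only the values on the half-plane Re s > \<alpha> matter. *)
definition hardy_H2 :: "real \<Rightarrow> (complex \<Rightarrow> 'v::complex_inner) set"
  where "hardy_H2 \<alpha> = {F. vector_holomorphic_on F {s. Re s > \<alpha>} \<and>
    (\<forall>\<sigma>>\<alpha>. integrable lebesgue (\<lambda>\<tau>. (norm (F (Complex \<sigma> \<tau>)))\<^sup>2)) \<and>
    bdd_above ((\<lambda>\<sigma>. sqrt (LINT \<tau>|lebesgue. (norm (F (Complex \<sigma> \<tau>)))\<^sup>2)) ` {\<alpha><..})}"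

(* The supremum is one of real numbers, hence meaningful only for F in hardy_H2 \<alpha>. *)
definition hardy_H2_norm :: "real \<Rightarrow> (complex \<Rightarrow> 'v::complex_inner) \<Rightarrow> real"
  where "hardy_H2_norm \<alpha> F =
    (SUP \<sigma>\<in>{\<alpha><..}. sqrt (LINT \<tau>|lebesgue. (norm (F (Complex \<sigma> \<tau>)))\<^sup>2))"

end

theory Submission
  imports Defs "HOL-Probability.Characteristic_Functions"
begin

text \<open>
  The statement is Plancherel's theorem on vertical lines. For \<open>\<sigma> > \<alpha>\<close> the function
  \<open>exp (- \<sigma> * t) * f t\<close> on the half-line is square integrable, and it is integrable because it is the product of
  two square integrable functions, \<open>exp (- (\<sigma> - \<alpha>) * t)\<close> and \<open>exp (- \<alpha> * t) * f t\<close>; its Fourier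
  transform at \<open>\<tau>\<close> is the Laplace transform of \<open>f\<close> at \<open>\<sigma> + i \<tau>\<close>. Hence the square integral of the
  Laplace transform over that line equals \<open>2 * pi\<close> times the integral of
  \<open>(norm (f t))\<^sup>2 * exp (- 2 * \<sigma> * t)\<close> (\<open>Plancherel_laplace_transform\<close>). This quantity increases as \<open>\<sigma>\<close> decreases, so its
  supremum is the limit \<open>\<sigma> \<rightarrow> \<alpha>\<close>, where dominated convergence identifies it with the square of the
  weighted norm (\<open>weighted_L2_norm_tendsto\<close>). Membership in the Hardy space also requires that the
  transform be holomorphic, which follows from a Taylor estimate of the difference quotients under
  the integral (\<open>vector_holomorphic_on_laplace_transform\<close>).

  The Hilbert space need not be separable, so Plancherel's theorem cannot be read off coordinate
  by coordinate in a countable basis. It is first proved for the indicators of two sets of finite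
  measure: the product of one transform with the conjugate of the other is the transform of the
  correlation \<open>w \<mapsto> measure (A \<inter> (B + w))\<close>, which is continuous at \<open>0\<close>, and Gaussian summation
  recovers its value there (\<open>Plancherel_indicator\<close>). Sesquilinearity extends the identity to
  simple functions with values in the Hilbert space (\<open>Plancherel_simple_function\<close>), and density
  extends it to all functions that are both integrable and square integrable: Fatou's lemma gives
  the inequality \<open>\<le>\<close>, and this inequality, applied to the error of approximation, gives equality
  (\<open>Plancherel\<close>).

  The Bochner integral is used through one property only: its inner product with a vector \<open>v\<close> is
  the scalar integral of the inner products with \<open>v\<close> (\<open>strong_integral_cinner\<close>). In a Hilbert
  space this determines the integral.
\<close>

section \<open>Complex inner product spaces\<close>

lemma scaleC_zero_right [simp]: "a *\<^sub>C (0::'a::complex_vector) = 0"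
  using scaleC_add_right[of a 0 0] by simp

lemma scaleC_zero_left [simp]: "0 *\<^sub>C (x::'a::complex_vector) = 0"
  using scaleC_add_left[of 0 0 x] by simp

lemma scaleC_one [simp]: "1 *\<^sub>C (x::'a::complex_vector) = x"
  using scaleC_of_real[of 1 x] by simp

lemma scaleC_minus_left: "(- a) *\<^sub>C (x::'a::complex_vector) = - (a *\<^sub>C x)"
  using scaleC_add_left[of a "- a" x] by (simp add: eq_neg_iff_add_eq_0 add.commute)

lemma scaleC_minus_right: "a *\<^sub>C (- x::'a::complex_vector) = - (a *\<^sub>C x)"
  using scaleC_add_right[of a x "- x"] by (simp add: eq_neg_iff_add_eq_0 add.commute)

lemma scaleC_diff_left: "(a - b) *\<^sub>C (x::'a::complex_vector) = a *\<^sub>C x - b *\<^sub>C x"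
  using scaleC_add_left[of a "- b" x] by (simp add: scaleC_minus_left)

lemma scaleC_diff_right: "a *\<^sub>C (x - y::'a::complex_vector) = a *\<^sub>C x - a *\<^sub>C y"
  using scaleC_add_right[of a x "- y"] by (simp add: scaleC_minus_right)

lemma cinner_zero_left [simp]: "cinner 0 (y::'a::complex_inner) = 0"
  using cinner_scaleC_left[of 0 0 y] by simp

lemma cinner_zero_right [simp]: "cinner (x::'a::complex_inner) 0 = 0"
  by (subst cinner_commute) simp

lemma cinner_minus_left: "cinner (- x) (y::'a::complex_inner) = - cinner x y"
  using cinner_add_left[of x "- x" y] by (simp add: eq_neg_iff_add_eq_0 add.commute)

lemma cinner_diff_left: "cinner (x - y) (z::'a::complex_inner) = cinner x z - cinner y z"
  using cinner_add_left[of x "- y" z] by (simp add: cinner_minus_left)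

lemma cinner_add_right: "cinner x (y + z::'a::complex_inner) = cinner x y + cinner x z"
  by (subst (1 2 3) cinner_commute) (simp add: cinner_add_left)

lemma cinner_diff_right: "cinner x (y - z::'a::complex_inner) = cinner x y - cinner x z"
  by (subst (1 2 3) cinner_commute) (simp add: cinner_diff_left)

lemma cinner_scaleC_right: "cinner x (a *\<^sub>C y::'a::complex_inner) = cnj a * cinner x y"
  by (subst (1 2) cinner_commute) (simp add: cinner_scaleC_left)

lemma cinner_scaleR_left: "cinner (r *\<^sub>R x) (y::'a::complex_inner) = r *\<^sub>R cinner x y"
  unfolding scaleC_of_real[of r x, symmetric] by (simp add: cinner_scaleC_left scaleR_conv_of_real)

lemma cinner_sum_left: "cinner (\<Sum>i\<in>I. x i) (y::'a::complex_inner) = (\<Sum>i\<in>I. cinner (x i) y)"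
  by (induction I rule: infinite_finite_induct) (auto simp: cinner_add_left)

lemma cinner_sum_right: "cinner x (\<Sum>i\<in>I. y i::'a::complex_inner) = (\<Sum>i\<in>I. cinner x (y i))"
  by (induction I rule: infinite_finite_induct) (auto simp: cinner_add_right)

lemma cinner_self: "cinner x (x::'a::complex_inner) = of_real ((norm x)\<^sup>2)"
proof -
  have "Im (cinner x x) = 0"
    using cinner_commute[of x x] by (metis add.inverse_inverse cnj.sel(2) equal_neg_zero)
  moreover have "sqrt (Re (cinner x x)) \<ge> 0"
    using cinner_norm[of x] norm_ge_zero[of x] by simp
  then have "Re (cinner x x) \<ge> 0"
    by simp
  ultimately show ?thesis
    by (simp add: complex_eq_iff cinner_norm)
qed

lemma norm_scaleC: "norm (a *\<^sub>C (x::'a::complex_inner)) = cmod a * norm x"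
proof -
  have "complex_of_real ((norm (a *\<^sub>C x))\<^sup>2) = of_real ((cmod a * norm x)\<^sup>2)"
    unfolding cinner_self[of "a *\<^sub>C x", symmetric] power_mult_distrib of_real_mult
      complex_norm_square cinner_self[of x, symmetric]
    by (simp add: cinner_scaleC_left cinner_scaleC_right)
  then have "(norm (a *\<^sub>C x))\<^sup>2 = (cmod a * norm x)\<^sup>2"
    unfolding of_real_eq_iff .
  then show ?thesis
    by (rule power2_eq_imp_eq) simp_all
qed

lemma cinner_Cauchy_Schwarz: "cmod (cinner x y) \<le> norm x * norm (y::'a::complex_inner)"
proof (cases "y = 0")
  case False
  define c where "c = cinner x y"
  define n where "n = (norm y)\<^sup>2"
  have n: "n > 0"
    using False by (simp add: n_def)
  define z where "z = x - (c / of_real n) *\<^sub>C y"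
  have "complex_of_real ((norm z)\<^sup>2) =
      cinner x x - cnj (c / n) * cinner x y - (c / n) * (cinner y x - cnj (c / n) * cinner y y)"
    unfolding cinner_self[symmetric] z_def cinner_diff_left cinner_diff_right
      cinner_scaleC_left cinner_scaleC_right by (simp add: algebra_simps)
  also have "cinner y x = cnj c"
    unfolding c_def by (rule cinner_commute)
  also have "cinner y y = of_real n"
    by (simp add: cinner_self n_def)
  also have "cinner x x - cnj (c / n) * cinner x y - (c / n) * (cnj c - cnj (c / n) * of_real n)
      = of_real ((norm x)\<^sup>2) - c * cnj c / n"
    using n by (simp add: cinner_self field_simps c_def[symmetric])
  also have "\<dots> = of_real ((norm x)\<^sup>2 - (cmod c)\<^sup>2 / n)"
    by (simp flip: complex_norm_square)
  finally have "(norm z)\<^sup>2 = (norm x)\<^sup>2 - (cmod c)\<^sup>2 / n"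
    unfolding of_real_eq_iff .
  then have "(cmod c)\<^sup>2 / n \<le> (norm x)\<^sup>2"
    using zero_le_power2[of "norm z"] by linarith
  then have "(cmod c)\<^sup>2 \<le> (norm x * norm y)\<^sup>2"
    using n by (simp add: divide_le_eq n_def power_mult_distrib)
  then show ?thesis
    unfolding c_def by (rule power2_le_imp_le) simp
qed simp

lemma bounded_linear_cinner_left: "bounded_linear (\<lambda>x::'a::complex_inner. cinner x y)"
  by (rule bounded_linear_intro[of _ "norm y"])
    (auto simp: cinner_add_left cinner_scaleR_left cinner_Cauchy_Schwarz)

text \<open>
  Identities between vector-valued integrals are checked weakly: this lemma reduces them to scalar
  integrals.
\<close>

lemma cinner_eqI:
  fixes x y :: "'a::complex_inner"
  assumes "\<And>v. cinner x v = cinner y v"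
  shows "x = y"
proof -
  have "cinner (x - y) (x - y) = 0"
    using assms by (simp add: cinner_diff_left)
  then show ?thesis
    unfolding cinner_self by simp
qed

lemma tendsto_scaleC:
  fixes g :: "'b \<Rightarrow> 'a::complex_inner"
  assumes "(f \<longlongrightarrow> a) F" "(g \<longlongrightarrow> b) F"
  shows "((\<lambda>x. f x *\<^sub>C g x) \<longlongrightarrow> a *\<^sub>C b) F"
proof -
  have "bounded_bilinear (\<lambda>a (x::'a). a *\<^sub>C x)"
  proof
    show "(r *\<^sub>R a) *\<^sub>C b = r *\<^sub>R a *\<^sub>C b" for r a and b :: 'a
      unfolding scaleC_of_real[symmetric, where x = "a *\<^sub>C b"]
      by (simp add: scaleC_scaleC scaleR_conv_of_real)
    show "a *\<^sub>C r *\<^sub>R b = r *\<^sub>R a *\<^sub>C b" for r a and b :: 'a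
      unfolding scaleC_of_real[symmetric] scaleC_scaleC by (simp add: mult.commute)
    show "\<exists>K. \<forall>a (b::'a). norm (a *\<^sub>C b) \<le> norm a * norm b * K"
      by (intro exI[of _ 1]) (simp add: norm_scaleC)
  qed (simp_all add: scaleC_add_left scaleC_add_right)
  then show ?thesis
    using assms by (rule bounded_bilinear.tendsto)
qed

section \<open>Strong measurability on complete measure spaces\<close>

text \<open>
  Strong measurability only gives convergence of simple functions almost everywhere. Completeness
  of the measure turns this into Borel measurability of every continuous real or complex image of
  the function, such as its norm or an inner product with a fixed vector, so that scalar Lebesgue
  integrals of these make sense even when the vector space is not separable.
\<close>

lemma (in complete_measure) borel_measurable_AE_eq:
  assumes g: "g \<in> borel_measurable M" and eq: "AE x in M. f x = g x"
  shows "f \<in> borel_measurable M"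
proof (rule measurableI)
  fix A :: "'b set" assume A: "A \<in> sets borel"
  have "{x\<in>space M. g x \<in> A} \<in> sets M"
    using measurable_sets[OF g A] by (simp add: vimage_def Int_def conj_commute)
  moreover have "AE x in M. x \<in> {x\<in>space M. g x \<in> A} \<longleftrightarrow> x \<in> f -` A \<inter> space M"
    using eq AE_space by eventually_elim auto
  ultimately show "f -` A \<inter> space M \<in> sets M"
    by (intro in_sets_AE[of "{x\<in>space M. g x \<in> A}" "f -` A \<inter> space M"]) simp_all
qed simp

lemma (in complete_measure) borel_measurable_AE_LIMSEQ:
  fixes f :: "'a \<Rightarrow> 'b::{banach, second_countable_topology}"
  assumes u: "\<And>i. u i \<in> borel_measurable M" and lim: "AE x in M. (\<lambda>i. u i x) \<longlonglongrightarrow> f x"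
  shows "f \<in> borel_measurable M"
proof (rule borel_measurable_AE_eq)
  show "(\<lambda>x. lim (\<lambda>i. u i x)) \<in> borel_measurable M"
    using u by (rule borel_measurable_lim_metric)
  show "AE x in M. f x = lim (\<lambda>i. u i x)"
    using lim by eventually_elim (simp add: limI)
qed

lemma (in complete_measure) strongly_measurable_continuous:
  fixes f :: "'a \<Rightarrow> 'b::real_normed_vector" and \<phi> :: "'b \<Rightarrow> 'c::{banach, second_countable_topology}"
  assumes f: "strongly_measurable M f" and \<phi>: "continuous_on UNIV \<phi>"
  shows "(\<lambda>x. \<phi> (f x)) \<in> borel_measurable M"
proof -
  from f obtain s where s: "\<And>i. simple_function M (s i)" "AE t in M. (\<lambda>i. s i t) \<longlonglongrightarrow> f t"
    unfolding strongly_measurable_def by auto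
  show ?thesis
  proof (rule borel_measurable_AE_LIMSEQ)
    show "(\<lambda>x. \<phi> (s i x)) \<in> borel_measurable M" for i
      by (rule borel_measurable_simple_function[OF simple_function_compose1[OF s(1)]])
    show "AE x in M. (\<lambda>i. \<phi> (s i x)) \<longlonglongrightarrow> \<phi> (f x)"
      using s(2)
    proof eventually_elim
      case (elim x)
      have "isCont \<phi> (f x)"
        using \<phi> by (simp add: continuous_on_eq_continuous_at)
      then show ?case
        using elim by (rule isCont_tendsto_compose)
    qed
  qed
qed

lemma strongly_measurable_scaleC:
  fixes f :: "'a \<Rightarrow> 'b::complex_inner"
  assumes "\<phi> \<in> borel_measurable M" "strongly_measurable M f"
  shows "strongly_measurable M (\<lambda>x. \<phi> x *\<^sub>C f x)"
proof -
  from assms(2) obtain s where s: "\<And>i. simple_function M (s i)" "AE t in M. (\<lambda>i. s i t) \<longlonglongrightarrow> f t"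
    unfolding strongly_measurable_def by auto
  from strongly_measurable_borel[OF assms(1)] obtain u where u: "\<And>i. simple_function M (u i)"
    "AE t in M. (\<lambda>i. u i t) \<longlonglongrightarrow> \<phi> t"
    unfolding strongly_measurable_def by auto
  show ?thesis
    unfolding strongly_measurable_def
  proof (intro exI[of _ "\<lambda>i t. u i t *\<^sub>C s i t"] conjI allI)
    show "simple_function M (\<lambda>t. u i t *\<^sub>C s i t)" for i
      by (rule simple_function_compose2[OF u(1) s(1)])
    show "AE t in M. (\<lambda>i. u i t *\<^sub>C s i t) \<longlonglongrightarrow> \<phi> t *\<^sub>C f t"
      using s(2) u(2) by eventually_elim (rule tendsto_scaleC)
  qed
qed

lemma strongly_measurable_diff:
  fixes f g :: "'a \<Rightarrow> 'b::real_normed_vector"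
  assumes "strongly_measurable M f" "strongly_measurable M g"
  shows "strongly_measurable M (\<lambda>x. f x - g x)"
proof -
  from assms obtain s u where s: "\<And>i. simple_function M (s i)" "AE t in M. (\<lambda>i. s i t) \<longlonglongrightarrow> f t"
    and u: "\<And>i. simple_function M (u i)" "AE t in M. (\<lambda>i. u i t) \<longlonglongrightarrow> g t"
    unfolding strongly_measurable_def by auto
  show ?thesis
    unfolding strongly_measurable_def
  proof (intro exI[of _ "\<lambda>i t. s i t - u i t"] conjI allI)
    show "simple_function M (\<lambda>t. s i t - u i t)" for i
      by (rule simple_function_compose2[OF s(1) u(1)])
    show "AE t in M. (\<lambda>i. s i t - u i t) \<longlonglongrightarrow> f t - g t"
      using s(2) u(2) by eventually_elim (rule tendsto_diff)
  qed
qed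

lemma strongly_measurable_simple_function:
  "simple_function M f \<Longrightarrow> strongly_measurable M f"
  unfolding strongly_measurable_def by (intro exI[of _ "\<lambda>_. f"]) auto

lemma complete_measure_lebesgue_on:
  assumes "S \<in> sets lebesgue"
  shows "complete_measure (lebesgue_on S)"
proof
  fix A B :: "'a set" assume *: "A \<subseteq> B" "B \<in> null_sets (lebesgue_on S)"
  then have "B \<in> null_sets lebesgue" "B \<subseteq> S"
    using assms by (auto simp: null_sets_restrict_space)
  have "A \<in> null_sets lebesgue"
    using *(1) \<open>B \<in> null_sets lebesgue\<close> by (rule completion.complete2)
  then show "A \<in> sets (lebesgue_on S)"
    using \<open>B \<subseteq> S\<close> *(1) assms by (simp add: sets_restrict_space_iff null_setsD2)
qed

section \<open>Approximation by simple functions\<close>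

lemma (in complete_measure) norm_measurable:
  fixes f :: "'a \<Rightarrow> 'b::real_normed_vector"
  assumes "strongly_measurable M f"
  shows "(\<lambda>x. norm (f x)) \<in> borel_measurable M"
  using assms by (rule strongly_measurable_continuous) (intro continuous_intros)

text \<open>
  The approximating simple functions are cut off to zero wherever their norm exceeds twice that of
  the limit. The cut-off set is measurable because it only involves norms, so the functions stay
  simple; at a point with \<open>g x \<noteq> 0\<close> the cut-off is eventually inactive, and at a zero of \<open>g\<close> it
  forces the value zero. Any factor larger than one would do.
\<close>

lemma (in complete_measure) dominated_simple_approximation:
  fixes g :: "'a \<Rightarrow> 'b::real_normed_vector"
  assumes g: "strongly_measurable M g"
  obtains h where "\<And>n. simple_function M (h n)" "\<And>n x. norm (h n x) \<le> 2 * norm (g x)"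
    "AE x in M. (\<lambda>n. h n x) \<longlonglongrightarrow> g x"
proof -
  from g obtain s where s: "\<And>i. simple_function M (s i)" "AE t in M. (\<lambda>i. s i t) \<longlonglongrightarrow> g t"
    unfolding strongly_measurable_def by auto
  define h where "h n x = (if norm (s n x) \<le> 2 * norm (g x) then s n x else 0)" for n x
  show thesis
  proof (rule that)
    show "simple_function M (h n)" for n
    proof -
      have [measurable]: "(\<lambda>x. norm (g x)) \<in> borel_measurable M" "(\<lambda>x. norm (s n x)) \<in> borel_measurable M"
        using g s(1)[of n] by (auto intro: norm_measurable strongly_measurable_simple_function)
      show ?thesis
        unfolding h_def
        by (rule simple_function_If[OF s(1) simple_function_const]) measurable
    qed
    show "norm (h n x) \<le> 2 * norm (g x)" for n x
      by (simp add: h_def)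
    show "AE x in M. (\<lambda>n. h n x) \<longlonglongrightarrow> g x"
      using s(2)
    proof eventually_elim
      case (elim x)
      show ?case
      proof (cases "g x = 0")
        case True
        then have "h n x = 0" for n
          by (simp add: h_def)
        then show ?thesis
          using True by simp
      next
        case False
        then have "norm (g x) < 2 * norm (g x)"
          by simp
        with tendsto_norm[OF elim] have "eventually (\<lambda>n. norm (s n x) < 2 * norm (g x)) sequentially"
          by (rule order_tendstoD(2))
        then have "eventually (\<lambda>n. s n x = h n x) sequentially"
          by eventually_elim (simp add: h_def)
        then show ?thesis
          using elim by (rule Lim_transform_eventually[rotated])
      qed
    qed
  qed
qed

text \<open>
  The exponents one and two are needed for the same approximating sequence: convergence in \<open>L\<^sup>1\<close>
  gives pointwise convergence of the transforms, convergence in \<open>L\<^sup>2\<close> that of the squared norms.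
\<close>

lemma (in complete_measure) norm_power_dominated_convergence:
  fixes g :: "'a \<Rightarrow> 'b::real_normed_vector"
  assumes g: "strongly_measurable M g" and h: "\<And>n. strongly_measurable M (h n)"
    and bound: "\<And>n x. norm (h n x) \<le> 2 * norm (g x)"
    and lim: "AE x in M. (\<lambda>n. h n x) \<longlonglongrightarrow> g x"
    and int: "integrable M (\<lambda>x. norm (g x) ^ p)" and p: "p > 0"
  shows integrable_norm_power_approx: "integrable M (\<lambda>x. norm (h n x) ^ p)"
    and integrable_norm_power_diff_approx: "integrable M (\<lambda>x. norm (g x - h n x) ^ p)"
    and norm_power_approx_tendsto: "(\<lambda>n. LINT x|M. norm (h n x) ^ p) \<longlonglongrightarrow> (LINT x|M. norm (g x) ^ p)"
    and norm_power_diff_approx_tendsto: "(\<lambda>n. LINT x|M. norm (g x - h n x) ^ p) \<longlonglongrightarrow> 0"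
proof -
  have m1 [measurable]: "(\<lambda>x. norm (h n x)) \<in> borel_measurable M" for n
    by (intro norm_measurable h)
  have m2 [measurable]: "(\<lambda>x. norm (g x)) \<in> borel_measurable M"
    by (intro norm_measurable g)
  have m3 [measurable]: "(\<lambda>x. norm (g x - h n x)) \<in> borel_measurable M" for n
    by (intro norm_measurable strongly_measurable_diff h g)
  have w: "integrable M (\<lambda>x. (3 * norm (g x)) ^ p)"
    using int by (simp add: power_mult_distrib)
  have b1: "norm (norm (h n x) ^ p) \<le> (3 * norm (g x)) ^ p" for n x
    using bound[of n x] norm_ge_zero[of "g x"] unfolding real_norm_def power_abs abs_norm_cancel
    by (intro power_mono norm_ge_zero) linarith
  have b2: "norm (norm (g x - h n x) ^ p) \<le> (3 * norm (g x)) ^ p" for n x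
    using bound[of n x] norm_triangle_ineq4[of "g x" "h n x"]
    unfolding real_norm_def power_abs abs_norm_cancel by (intro power_mono norm_ge_zero) linarith
  have l1: "AE x in M. (\<lambda>n. norm (h n x) ^ p) \<longlonglongrightarrow> norm (g x) ^ p"
    using lim by eventually_elim (intro tendsto_intros)
  have l2: "AE x in M. (\<lambda>n. norm (g x - h n x) ^ p) \<longlonglongrightarrow> 0"
    using lim
  proof eventually_elim
    case (elim x)
    from tendsto_power[OF tendsto_norm[OF tendsto_diff[OF tendsto_const[of "g x"] elim]], of p]
    show ?case
      using p by (simp add: zero_power)
  qed
  show "integrable M (\<lambda>x. norm (h n x) ^ p)"
    by (rule Bochner_Integration.integrable_bound[OF w]) (use b1[of n] in \<open>auto simp: abs_le_iff\<close>)
  show "integrable M (\<lambda>x. norm (g x - h n x) ^ p)"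
    by (rule Bochner_Integration.integrable_bound[OF w]) (use b2[of _ n] in \<open>auto simp: abs_le_iff\<close>)
  show "(\<lambda>n. LINT x|M. norm (h n x) ^ p) \<longlonglongrightarrow> (LINT x|M. norm (g x) ^ p)"
    by (rule integral_dominated_convergence[OF _ _ w l1]) (use b1 in auto)
  show "(\<lambda>n. LINT x|M. norm (g x - h n x) ^ p) \<longlonglongrightarrow> 0"
    using integral_dominated_convergence[OF _ _ w l2] b2 by simp
qed

section \<open>The Bochner integral in a Hilbert space\<close>

definition strongly_integrable :: "'a measure \<Rightarrow> ('a \<Rightarrow> 'b::real_normed_vector) \<Rightarrow> bool"
  where "strongly_integrable M g \<longleftrightarrow> strongly_measurable M g \<and> integrable M (\<lambda>x. norm (g x))"

lemma (in complete_measure) strongly_integrable_bound: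
  assumes "strongly_measurable M g" "integrable M w" "\<And>x. x \<in> space M \<Longrightarrow> norm (g x) \<le> w x"
  shows "strongly_integrable M g"
  unfolding strongly_integrable_def
proof
  show "integrable M (\<lambda>x. norm (g x))"
  proof (rule Bochner_Integration.integrable_bound[OF assms(2) norm_measurable[OF assms(1)]])
    show "AE x in M. norm (norm (g x)) \<le> norm (w x)"
      using AE_space by eventually_elim (use assms(3) in force)
  qed
qed (rule assms(1))

lemma (in complete_measure) strongly_integrable_diff:
  assumes "strongly_integrable M f" "strongly_integrable M g"
  shows "strongly_integrable M (\<lambda>x. f x - g x)"
proof (rule strongly_integrable_bound[OF _ _ norm_triangle_ineq4])
  show "strongly_measurable M (\<lambda>x. f x - g x)"
    using assms by (auto simp: strongly_integrable_def intro: strongly_measurable_diff)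
  show "integrable M (\<lambda>x. norm (f x) + norm (g x))"
    using assms by (auto simp: strongly_integrable_def)
qed

text \<open>
  The integrals of the approximating simple functions differ by at most the sum of their \<open>L\<^sup>1\<close>
  distances to \<open>g\<close>, so they form a Cauchy sequence, and the space is complete.
\<close>

lemma (in complete_measure) has_strong_integral_exists:
  fixes g :: "'a \<Rightarrow> 'b::banach"
  assumes "strongly_integrable M g"
  shows "\<exists>x. has_strong_integral M g x"
proof -
  from assms have g: "strongly_measurable M g" and int: "integrable M (\<lambda>x. norm (g x))"
    by (auto simp: strongly_integrable_def)
  obtain h where h: "\<And>n. simple_function M (h n)" "\<And>n x. norm (h n x) \<le> 2 * norm (g x)"
    "AE x in M. (\<lambda>n. h n x) \<longlonglongrightarrow> g x"
    using dominated_simple_approximation[OF g] by blast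
  note sm = h(1)[THEN strongly_measurable_simple_function]
  note approx = norm_power_dominated_convergence[OF g sm h(2,3), where p = 1, unfolded power_one_right,
      OF int zero_less_one]
  define e where "e n = (LINT x|M. norm (g x - h n x))" for n
  have e: "e \<longlonglongrightarrow> 0"
    unfolding e_def by (rule approx)
  have nn: "(\<integral>\<^sup>+x. ennreal (norm (g x - h n x)) \<partial>M) = ennreal (e n)" for n
    unfolding e_def by (rule nn_integral_eq_integral[OF approx(2)]) simp
  have sbi: "Bochner_Integration.simple_bochner_integrable M (h n)" for n
  proof (rule simple_bochner_integrableI_bounded[OF h(1)])
    have "(\<integral>\<^sup>+x. ennreal (norm (h n x)) \<partial>M) = ennreal (LINT x|M. norm (h n x))"
      by (rule nn_integral_eq_integral[OF approx(1)]) simp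
    then show "(\<integral>\<^sup>+x. ennreal (norm (h n x)) \<partial>M) < \<infinity>"
      by simp
  qed
  define y where "y n = Bochner_Integration.simple_bochner_integral M (h n)" for n
  have cauchy: "norm (y m - y n) \<le> e m + e n" for m n
  proof -
    have d: "Bochner_Integration.simple_bochner_integrable M (\<lambda>x. h m x - h n x)"
      using simple_bochner_integrable_compose2[of "(-)", OF _ sbi sbi] by simp
    have d': "Bochner_Integration.simple_bochner_integrable M (\<lambda>x. norm (h m x - h n x))"
      using simple_bochner_integrable_compose2[of "\<lambda>x y. norm (x - y)", OF _ sbi sbi] by simp
    have "norm (y m - y n) = norm (Bochner_Integration.simple_bochner_integral M (\<lambda>x. h m x - h n x))"
      unfolding y_def by (simp add: simple_bochner_integral_diff[OF sbi sbi])
    also have "\<dots> \<le> Bochner_Integration.simple_bochner_integral M (\<lambda>x. norm (h m x - h n x))"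
      by (rule simple_bochner_integral_norm_bound[OF d])
    finally have "ennreal (norm (y m - y n)) \<le> (\<integral>\<^sup>+x. norm (h m x - h n x) \<partial>M)"
      by (simp flip: simple_bochner_integral_eq_nn_integral[OF d'] add: ennreal_leI)
    also have "\<dots> \<le> (\<integral>\<^sup>+x. ennreal (norm (g x - h m x) + norm (g x - h n x)) \<partial>M)"
    proof (intro nn_integral_mono ennreal_leI)
      show "norm (h m x - h n x) \<le> norm (g x - h m x) + norm (g x - h n x)" for x
        using norm_triangle_ineq4[of "g x - h n x" "g x - h m x"] by simp
    qed
    also have "\<dots> = ennreal (LINT x|M. norm (g x - h m x) + norm (g x - h n x))"
      by (rule nn_integral_eq_integral) (auto intro!: approx)
    also have "\<dots> = ennreal (e m + e n)"
      unfolding e_def by (simp add: approx)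
    finally show ?thesis
      by (subst (asm) ennreal_le_iff) (auto simp: e_def)
  qed
  have "Cauchy y"
  proof (rule CauchyI)
    fix \<epsilon> :: real assume "\<epsilon> > 0"
    then have "eventually (\<lambda>n. e n < \<epsilon> / 2) sequentially"
      using order_tendstoD(2)[OF e, of "\<epsilon> / 2"] by simp
    then obtain N where N: "\<And>n. n \<ge> N \<Longrightarrow> e n < \<epsilon> / 2"
      unfolding eventually_sequentially by auto
    show "\<exists>N. \<forall>m\<ge>N. \<forall>n\<ge>N. norm (y m - y n) < \<epsilon>"
    proof (intro exI allI impI)
      fix m n assume "m \<ge> N" "n \<ge> N"
      then show "norm (y m - y n) < \<epsilon>"
        using N[of m] N[of n] cauchy[of m n] by linarith
    qed
  qed
  then obtain x where "y \<longlonglongrightarrow> x"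
    using Cauchy_convergent unfolding convergent_def by blast
  moreover have "(\<lambda>n. \<integral>\<^sup>+x. ennreal (norm (g x - h n x)) \<partial>M) \<longlonglongrightarrow> 0"
    unfolding nn using tendsto_ennrealI[OF e] by simp
  ultimately show ?thesis
    unfolding has_strong_integral_def y_def using g sbi by blast
qed

text \<open>
  A bounded functional can be moved inside the integral. Together with \<open>cinner_eqI\<close> this yields
  uniqueness of the integral, its linearity and its norm bound without returning to simple
  functions.
\<close>

lemma (in complete_measure) has_strong_integral_cinner:
  fixes g :: "'a \<Rightarrow> 'b::complex_inner"
  assumes "has_strong_integral M g x"
  shows "has_bochner_integral M (\<lambda>t. cinner (g t) v) (cinner x v)"
proof -
  from assms obtain s where g: "strongly_measurable M g"
    and s: "\<And>i. Bochner_Integration.simple_bochner_integrable M (s i)"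
      "(\<lambda>i. \<integral>\<^sup>+t. ennreal (norm (g t - s i t)) \<partial>M) \<longlonglongrightarrow> 0"
      "(\<lambda>i. Bochner_Integration.simple_bochner_integral M (s i)) \<longlonglongrightarrow> x"
    unfolding has_strong_integral_def by blast
  interpret L: bounded_linear "\<lambda>x. cinner x v"
    by (rule bounded_linear_cinner_left)
  have sf: "simple_function M (s i)" for i
    using s(1)[of i] by (auto elim: simple_bochner_integrable.cases)
  show ?thesis
  proof (rule has_bochner_integral.intros)
    show "(\<lambda>t. cinner (g t) v) \<in> borel_measurable M"
      by (rule strongly_measurable_continuous[OF g]) (intro L.continuous_on continuous_intros)
    show "Bochner_Integration.simple_bochner_integrable M (\<lambda>t. cinner (s i t) v)" for i
      using simple_bochner_integrable_compose2[of "\<lambda>x y. cinner x v", OF _ s(1) s(1)] by simp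
    show "(\<lambda>i. Bochner_Integration.simple_bochner_integral M (\<lambda>t. cinner (s i t) v)) \<longlonglongrightarrow> cinner x v"
      using L.tendsto[OF s(3)] by (simp add: simple_bochner_integral_linear[OF L.linear s(1)])
    have "(\<lambda>i. ennreal (norm v) * (\<integral>\<^sup>+t. ennreal (norm (g t - s i t)) \<partial>M)) \<longlonglongrightarrow> ennreal (norm v) * 0"
      by (intro ennreal_tendsto_cmult s(2)) simp
    then have lim: "(\<lambda>i. ennreal (norm v) * (\<integral>\<^sup>+t. ennreal (norm (g t - s i t)) \<partial>M)) \<longlonglongrightarrow> 0"
      by simp
    show "(\<lambda>i. \<integral>\<^sup>+t. ennreal (norm (cinner (g t) v - cinner (s i t) v)) \<partial>M) \<longlonglongrightarrow> 0"
    proof (rule tendsto_sandwich[OF _ _ tendsto_const lim])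
      show "eventually (\<lambda>i. (\<integral>\<^sup>+t. ennreal (norm (cinner (g t) v - cinner (s i t) v)) \<partial>M)
          \<le> ennreal (norm v) * (\<integral>\<^sup>+t. ennreal (norm (g t - s i t)) \<partial>M)) sequentially"
      proof (intro always_eventually allI)
        fix i
        have m: "(\<lambda>t. norm (g t - s i t)) \<in> borel_measurable M"
          using sf by (intro norm_measurable strongly_measurable_diff g strongly_measurable_simple_function)
        have "(\<integral>\<^sup>+t. ennreal (norm (cinner (g t) v - cinner (s i t) v)) \<partial>M)
            \<le> (\<integral>\<^sup>+t. ennreal (norm v) * ennreal (norm (g t - s i t)) \<partial>M)"
        proof (rule nn_integral_mono)
          fix t
          show "ennreal (norm (cinner (g t) v - cinner (s i t) v)) \<le> ennreal (norm v) * ennreal (norm (g t - s i t))"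
            using cinner_Cauchy_Schwarz[of "g t - s i t" v]
            by (simp add: cinner_diff_left ennreal_leI mult.commute flip: ennreal_mult)
        qed
        also have "\<dots> = ennreal (norm v) * (\<integral>\<^sup>+t. ennreal (norm (g t - s i t)) \<partial>M)"
          by (rule nn_integral_cmult[OF measurable_compose[OF m measurable_ennreal]])
        finally show "(\<integral>\<^sup>+t. ennreal (norm (cinner (g t) v - cinner (s i t) v)) \<partial>M)
          \<le> ennreal (norm v) * (\<integral>\<^sup>+t. ennreal (norm (g t - s i t)) \<partial>M)" .
      qed
    qed simp
  qed
qed

lemma (in complete_measure) strong_integral_cinner:
  fixes g :: "'a \<Rightarrow> 'b::chilbert_space"
  assumes "strongly_integrable M g"
  shows "has_bochner_integral M (\<lambda>t. cinner (g t) v) (cinner (strong_integral M g) v)"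
proof -
  obtain x where x: "has_strong_integral M g x"
    using has_strong_integral_exists[OF assms] by blast
  have "y = x" if "has_strong_integral M g y" for y
    by (rule cinner_eqI) (rule has_bochner_integral_eq[OF has_strong_integral_cinner[OF that]
          has_strong_integral_cinner[OF x]])
  then have "strong_integral M g = x"
    unfolding strong_integral_def using x by (metis the_equality)
  then show ?thesis
    using has_strong_integral_cinner[OF x] by simp
qed

lemma (in complete_measure) strong_integral_eqI:
  fixes g :: "'a \<Rightarrow> 'b::chilbert_space"
  assumes "strongly_integrable M g"
    and "\<And>v. has_bochner_integral M (\<lambda>t. cinner (g t) v) (cinner x v)"
  shows "strong_integral M g = x"
  by (rule cinner_eqI) (rule has_bochner_integral_eq[OF strong_integral_cinner[OF assms(1)] assms(2)])

lemma (in complete_measure) strong_integral_diff: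
  fixes f g :: "'a \<Rightarrow> 'b::chilbert_space"
  assumes "strongly_integrable M f" "strongly_integrable M g"
  shows "strong_integral M (\<lambda>x. f x - g x) = strong_integral M f - strong_integral M g"
proof (rule strong_integral_eqI)
  show "strongly_integrable M (\<lambda>x. f x - g x)"
    using assms by (rule strongly_integrable_diff)
  show "has_bochner_integral M (\<lambda>t. cinner (f t - g t) v)
      (cinner (strong_integral M f - strong_integral M g) v)" for v
    unfolding cinner_diff_left by (intro has_bochner_integral_diff strong_integral_cinner assms)
qed

lemma (in complete_measure) strong_integral_scaleC:
  fixes g :: "'a \<Rightarrow> 'b::chilbert_space"
  assumes "strongly_integrable M g"
  shows "strong_integral M (\<lambda>x. c *\<^sub>C g x) = c *\<^sub>C strong_integral M g"
proof (rule strong_integral_eqI)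
  show "strongly_integrable M (\<lambda>x. c *\<^sub>C g x)"
    using assms by (simp add: strongly_integrable_def strongly_measurable_scaleC norm_scaleC)
  show "has_bochner_integral M (\<lambda>t. cinner (c *\<^sub>C g t) v) (cinner (c *\<^sub>C strong_integral M g) v)" for v
    unfolding cinner_scaleC_left
    by (intro has_bochner_integral_mult_right strong_integral_cinner assms)
qed

text \<open>
  If \<open>x\<close> denotes the integral, then \<open>(norm x)\<^sup>2\<close> is the integral of \<open>cinner (g t) x\<close>, which the
  Cauchy--Schwarz inequality bounds by \<open>norm x\<close> times the integral of \<open>norm (g t)\<close>.
\<close>

lemma (in complete_measure) norm_strong_integral_le:
  fixes g :: "'a \<Rightarrow> 'b::chilbert_space"
  assumes "strongly_integrable M g"
  shows "norm (strong_integral M g) \<le> (LINT t|M. norm (g t))"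
proof -
  define x where "x = strong_integral M g"
  have int: "integrable M (\<lambda>t. norm (g t))"
    using assms by (simp add: strongly_integrable_def)
  have hb: "has_bochner_integral M (\<lambda>t. cinner (g t) x) (cinner x x)"
    unfolding x_def by (rule strong_integral_cinner[OF assms])
  have "norm (cinner x x) \<le> (LINT t|M. norm (cinner (g t) x))"
    using hb integral_norm_bound[of M "\<lambda>t. cinner (g t) x"]
    by (simp add: has_bochner_integral_integral_eq)
  also have "\<dots> \<le> (LINT t|M. norm (g t) * norm x)"
    using hb int by (intro integral_mono cinner_Cauchy_Schwarz)
      (auto simp: has_bochner_integral_iff)
  also have "\<dots> = (LINT t|M. norm (g t)) * norm x"
    by simp
  finally have *: "norm x * norm x \<le> (LINT t|M. norm (g t)) * norm x"
    unfolding cinner_self norm_of_real by (simp add: power2_eq_square)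
  show ?thesis
  proof (cases "norm x = 0")
    case True
    then show ?thesis
      using assms by (simp add: x_def[symmetric])
  next
    case False
    then show ?thesis
      using * by (simp add: x_def[symmetric])
  qed
qed

section \<open>Gaussian summation of the scalar Fourier transform\<close>

definition fourier :: "(real \<Rightarrow> complex) \<Rightarrow> real \<Rightarrow> complex"
  where "fourier m \<tau> = (LINT t|lborel. m t * iexp (- (\<tau> * t)))"

text \<open>
  Up to scaling the Gaussian is its own Fourier transform: for \<open>\<epsilon> = 1\<close> this is the characteristic
  function of the standard normal distribution, and the general case is a change of variable.
\<close>

lemma fourier_std_normal_density:
  assumes "\<epsilon> > 0"
  shows "(LINT \<tau>|lborel. std_normal_density (\<epsilon> * \<tau>) *\<^sub>R iexp (- (\<tau> * w))) =
    of_real (exp (- (w / \<epsilon>)\<^sup>2 / 2) / \<epsilon>)"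
proof -
  have "(LINT \<tau>|lborel. std_normal_density (\<epsilon> * \<tau>) *\<^sub>R iexp (- (\<tau> * w))) =
      \<bar>1 / \<epsilon>\<bar> *\<^sub>R (LINT x|lborel. std_normal_density x *\<^sub>R iexp ((- (w / \<epsilon>)) * x))"
    using assms by (subst lborel_integral_real_affine[of "1 / \<epsilon>" _ 0]) (auto simp: field_simps)
  also have "(LINT x|lborel. std_normal_density x *\<^sub>R iexp ((- (w / \<epsilon>)) * x)) =
      char std_normal_distribution (- (w / \<epsilon>))"
    unfolding char_def by (subst integral_density) auto
  also have "\<bar>1 / \<epsilon>\<bar> *\<^sub>R \<dots> = of_real (exp (- (w / \<epsilon>)\<^sup>2 / 2) / \<epsilon>)"
    using assms unfolding char_std_normal_distribution
    by (simp add: scaleR_conv_of_real field_simps)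
  finally show ?thesis .
qed

lemma integrable_std_normal_density_scaled:
  assumes "\<epsilon> > 0"
  shows "integrable lborel (\<lambda>\<tau>. std_normal_density (\<epsilon> * \<tau>))"
  using lborel_integrable_real_affine[OF integrable_normal_density[of 1 0], of \<epsilon> 0] assms by simp

text \<open>
  By Fubini the transform moves from \<open>m\<close> to the Gaussian. The substitution \<open>w = \<epsilon> * x\<close> then puts
  \<open>\<epsilon>\<close> into the argument of \<open>m\<close>, ready for the limit \<open>\<epsilon> \<rightarrow> 0\<close>.
\<close>

lemma integral_fourier_std_normal_density:
  assumes m: "integrable lborel m" and \<epsilon>: "\<epsilon> > 0"
  shows "(LINT \<tau>|lborel. std_normal_density (\<epsilon> * \<tau>) *\<^sub>R fourier m \<tau>) =
    (LINT x|lborel. exp (- x\<^sup>2 / 2) *\<^sub>R m (\<epsilon> * x))"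
proof -
  have [measurable]: "m \<in> borel_measurable borel"
    using borel_measurable_integrable[OF m] by simp
  define F where "F w \<tau> = (m w * iexp (- (\<tau> * w))) * of_real (std_normal_density (\<epsilon> * \<tau>))" for w \<tau>
  have F: "integrable (lborel \<Otimes>\<^sub>M lborel) (case_prod F)"
  proof (rule lborel_pair.Fubini_integrable)
    show "case_prod F \<in> borel_measurable (lborel \<Otimes>\<^sub>M lborel)"
      unfolding F_def by measurable
    have "(\<lambda>w. LINT \<tau>|lborel. norm (case (w, \<tau>) of (w, \<tau>) \<Rightarrow> F w \<tau>)) =
        (\<lambda>w. norm (m w) * (LINT \<tau>|lborel. std_normal_density (\<epsilon> * \<tau>)))"
      by (simp add: F_def norm_mult)
    then show "integrable lborel (\<lambda>w. LINT \<tau>|lborel. norm (case (w, \<tau>) of (w, \<tau>) \<Rightarrow> F w \<tau>))"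
      using m by simp
    have "integrable lborel (F w)" for w
      unfolding F_def
      by (rule Bochner_Integration.integrable_bound[where
            f = "\<lambda>\<tau>. norm (m w) * std_normal_density (\<epsilon> * \<tau>)"])
        (auto simp: norm_mult intro!: integrable_std_normal_density_scaled \<epsilon>)
    then show "AE w in lborel. integrable lborel (\<lambda>\<tau>. case (w, \<tau>) of (w, \<tau>) \<Rightarrow> F w \<tau>)"
      by simp
  qed
  have "(LINT \<tau>|lborel. std_normal_density (\<epsilon> * \<tau>) *\<^sub>R fourier m \<tau>) =
      (LINT \<tau>|lborel. LINT w|lborel. F w \<tau>)"
    unfolding fourier_def F_def scaleR_conv_of_real by (simp add: mult.commute)
  also have "\<dots> = (LINT w|lborel. LINT \<tau>|lborel. F w \<tau>)"
    by (rule lborel_pair.Fubini_integral[OF F])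
  also have "\<dots> = (LINT w|lborel. m w * of_real (exp (- (w / \<epsilon>)\<^sup>2 / 2) / \<epsilon>))"
  proof (rule Bochner_Integration.integral_cong)
    fix w
    have "(LINT \<tau>|lborel. F w \<tau>) =
        (LINT \<tau>|lborel. m w * (std_normal_density (\<epsilon> * \<tau>) *\<^sub>R iexp (- (\<tau> * w))))"
      unfolding F_def scaleR_conv_of_real by (simp add: ac_simps)
    also have "\<dots> = m w * of_real (exp (- (w / \<epsilon>)\<^sup>2 / 2) / \<epsilon>)"
      unfolding fourier_std_normal_density[OF \<epsilon>, symmetric] by (rule integral_mult_right_zero)
    finally show "(LINT \<tau>|lborel. F w \<tau>) = m w * of_real (exp (- (w / \<epsilon>)\<^sup>2 / 2) / \<epsilon>)" .
  qed simp
  also have "\<dots> = \<bar>\<epsilon>\<bar> *\<^sub>R (LINT x|lborel. m (0 + \<epsilon> * x) * of_real (exp (- ((0 + \<epsilon> * x) / \<epsilon>)\<^sup>2 / 2) / \<epsilon>))"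
    by (rule lborel_integral_real_affine) (use \<epsilon> in simp)
  also have "\<dots> = (LINT x|lborel. \<bar>\<epsilon>\<bar> *\<^sub>R (m (0 + \<epsilon> * x) * of_real (exp (- ((0 + \<epsilon> * x) / \<epsilon>)\<^sup>2 / 2) / \<epsilon>)))"
    by (rule integral_scaleR_right[symmetric])
  also have "\<dots> = (LINT x|lborel. exp (- x\<^sup>2 / 2) *\<^sub>R m (\<epsilon> * x))"
    by (rule Bochner_Integration.integral_cong) (use \<epsilon> in \<open>auto simp: scaleR_conv_of_real\<close>)
  finally show ?thesis .
qed

lemma integrable_exp_square: "integrable lborel (\<lambda>x. exp (- x\<^sup>2 / 2) :: real)"
  and integral_exp_square: "(LINT x|lborel. exp (- x\<^sup>2 / 2) :: real) = sqrt (2 * pi)"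
proof -
  have eq: "exp (- x\<^sup>2 / 2) = sqrt (2 * pi) * std_normal_density x" for x :: real
    by (simp add: std_normal_density_def)
  show "integrable lborel (\<lambda>x. exp (- x\<^sup>2 / 2) :: real)"
    unfolding eq by simp
  show "(LINT x|lborel. exp (- x\<^sup>2 / 2) :: real) = sqrt (2 * pi)"
    unfolding eq by simp
qed

text \<open>
  Fourier inversion at the single point \<open>0\<close>, for a function whose transform need not be
  integrable: a slowly varying Gaussian factor replaces integrability.
\<close>

lemma Gauss_summation_fourier:
  assumes m: "integrable lborel m" and bound: "\<And>x. norm (m x) \<le> C" and cont: "isCont m 0"
  shows "(\<lambda>n. LINT \<tau>|lborel. std_normal_density (\<tau> / real (Suc n)) *\<^sub>R fourier m \<tau>)
    \<longlonglongrightarrow> sqrt (2 * pi) *\<^sub>R m 0"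
proof -
  have [measurable]: "m \<in> borel_measurable borel"
    using borel_measurable_integrable[OF m] by simp
  have "(\<lambda>n. LINT x|lborel. exp (- x\<^sup>2 / 2) *\<^sub>R m (inverse (real (Suc n)) * x))
      \<longlonglongrightarrow> (LINT x|lborel. exp (- x\<^sup>2 / 2) *\<^sub>R m 0)"
  proof (rule integral_dominated_convergence[where w = "\<lambda>x. exp (- x\<^sup>2 / 2) * C"])
    show "integrable lborel (\<lambda>x. exp (- x\<^sup>2 / 2) * C)"
      by (intro integrable_mult_left integrable_exp_square)
    show "AE x in lborel. (\<lambda>n. exp (- x\<^sup>2 / 2) *\<^sub>R m (inverse (real (Suc n)) * x))
        \<longlonglongrightarrow> exp (- x\<^sup>2 / 2) *\<^sub>R m 0"
    proof (intro AE_I2 tendsto_scaleR tendsto_const isCont_tendsto_compose[OF cont])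
      show "(\<lambda>n. inverse (real (Suc n)) * x) \<longlonglongrightarrow> 0" for x
        using tendsto_mult[OF LIMSEQ_inverse_real_of_nat tendsto_const[of x]] by simp
    qed
    show "AE x in lborel. norm (exp (- x\<^sup>2 / 2) *\<^sub>R m (inverse (real (Suc n)) * x)) \<le> exp (- x\<^sup>2 / 2) * C" for n
      by (intro AE_I2) (simp add: bound)
  qed measurable
  also have "(LINT x|lborel. exp (- x\<^sup>2 / 2) *\<^sub>R m 0) = sqrt (2 * pi) *\<^sub>R m 0"
    unfolding integral_exp_square[symmetric] by (rule integral_scaleR_left) (rule integrable_exp_square)
  also have "(\<lambda>n. LINT x|lborel. exp (- x\<^sup>2 / 2) *\<^sub>R m (inverse (real (Suc n)) * x)) =
      (\<lambda>n. LINT \<tau>|lborel. std_normal_density (\<tau> / real (Suc n)) *\<^sub>R fourier m \<tau>)"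
  proof
    fix n
    have eq: "\<tau> / real (Suc n) = inverse (real (Suc n)) * \<tau>" for \<tau>
      by (simp add: divide_inverse)
    show "(LINT x|lborel. exp (- x\<^sup>2 / 2) *\<^sub>R m (inverse (real (Suc n)) * x)) =
        (LINT \<tau>|lborel. std_normal_density (\<tau> / real (Suc n)) *\<^sub>R fourier m \<tau>)"
      unfolding eq by (rule integral_fourier_std_normal_density[OF m, symmetric]) simp
  qed
  finally show ?thesis .
qed

section \<open>Plancherel's identity for indicator functions\<close>

text \<open>
  Enclose \<open>B\<close> between a compact \<open>K\<close> and an open \<open>U\<close> with \<open>U - K\<close> small. A translation shorter than
  the distance from \<open>K\<close> to the complement of \<open>U\<close> keeps \<open>K\<close> inside \<open>U\<close>, so the indicator can change
  at \<open>t\<close> only if \<open>t\<close> or \<open>t - w\<close> lies in \<open>U - K\<close>.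
\<close>

lemma tendsto_translate_indicator:
  assumes B: "B \<in> sets borel" and fin: "emeasure lborel B < \<infinity>" and e: "e > 0"
  shows "\<exists>\<delta>>0. \<forall>w::real. \<bar>w\<bar> < \<delta> \<longrightarrow>
    (LINT t|lborel. \<bar>indicator B (t - w) - indicator B t\<bar> :: real) < e"
proof -
  \<comment> \<open>The final bound on the integral is \<open>4 * \<eta>\<close>.\<close>
  define \<eta> where "\<eta> = e / 8"
  have \<eta>: "\<eta> > 0"
    using e by (simp add: \<eta>_def)
  note [measurable] = B
  \<comment> \<open>Inner regularity by compact sets requires a finite measure, hence the restriction of
    Lebesgue measure to \<open>B\<close>.\<close>
  define M where "M = density lborel (indicator B :: real \<Rightarrow> ennreal)"
  have eM: "emeasure M X = emeasure lborel (B \<inter> X)" if "X \<in> sets borel" for X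
    unfolding M_def using that by (subst emeasure_density) (auto simp flip: indicator_inter_arith)
  have "emeasure M B = (SUP K\<in>{K. K \<subseteq> B \<and> compact K}. emeasure M K)"
    by (rule inner_regular) (use fin B eM in \<open>auto simp: M_def\<close>)
  then have sup: "emeasure lborel B = (SUP K\<in>{K. K \<subseteq> B \<and> compact K}. emeasure M K)"
    using eM[OF B] by simp
  have "\<exists>K. K \<subseteq> B \<and> compact K \<and> emeasure lborel B < emeasure M K + \<eta>"
  proof -
    have "{K. K \<subseteq> B \<and> compact K} \<noteq> {}"
      by (auto intro!: exI[of _ "{}"])
    from SUP_approx_ennreal[OF _ this sup, of \<eta>] show ?thesis
      using \<eta> fin by auto
  qed
  then obtain K where K: "K \<subseteq> B" "compact K" "emeasure lborel B < emeasure M K + \<eta>"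
    by auto
  have Kb [measurable]: "K \<in> sets borel"
    using K(2) by (rule borel_compact)
  obtain U where U: "open U" "B \<subseteq> U" "emeasure lborel (U - B) < \<eta>"
    using outer_regular_lborel[OF B \<eta>] by blast
  have Ub [measurable]: "U \<in> sets borel"
    using U(1) by simp
  obtain \<delta> where \<delta>: "\<delta> > 0" "(\<Union>x\<in>K. ball x \<delta>) \<subseteq> U"
    using compact_subset_open_imp_ball_epsilon_subset[OF K(2) U(1)] K(1) U(2) by blast
  have BK: "emeasure lborel (B - K) < \<eta>"
  proof -
    have "B \<inter> K = K" and split: "B = K \<union> (B - K)"
      using K(1) by auto
    then have "emeasure lborel K + emeasure lborel (B - K) < emeasure lborel K + \<eta>"
      using K(3) eM[OF Kb] plus_emeasure[of K lborel "B - K"] by auto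
    then show ?thesis
      by (simp add: ennreal_add_left_cancel_less)
  qed
  have UK: "emeasure lborel (U - K) < ennreal (2 * \<eta>)"
  proof -
    have "emeasure lborel (U - K) \<le> emeasure lborel ((U - B) \<union> (B - K))"
      by (intro emeasure_mono) auto
    also have "\<dots> \<le> emeasure lborel (U - B) + emeasure lborel (B - K)"
      by (intro emeasure_subadditive) auto
    also have "\<dots> < ennreal \<eta> + ennreal \<eta>"
      by (rule add_strict_mono[OF U(3) BK])
    finally show ?thesis
      using \<eta> by (simp flip: ennreal_plus)
  qed
  show ?thesis
  proof (intro exI[of _ \<delta>] conjI allI impI \<delta>(1))
    fix w :: real assume w: "\<bar>w\<bar> < \<delta>"
    let ?D = "\<lambda>t. indicator (U - K) t :: real"
    have D: "integrable lborel ?D"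
      using UK by (intro integrable_real_indicator) (auto intro: order.strict_trans)
    have D': "integrable lborel (\<lambda>t. ?D (t - w))"
      using lborel_integrable_real_affine[OF D, of 1 "- w"] by simp
    have le: "\<bar>indicator B (t - w) - indicator B t\<bar> \<le> ?D t + ?D (t - w)" for t
    proof -
      have "t - w \<in> U" if "t \<in> K"
        using that \<delta>(2) w by (force simp: dist_real_def)
      moreover have "t \<in> U" if "t - w \<in> K"
        using that \<delta>(2) w by (force simp: dist_real_def)
      ultimately show ?thesis
        using K(1) U(2) by (auto split: split_indicator)
    qed
    have "(LINT t|lborel. \<bar>indicator B (t - w) - indicator B t\<bar> :: real) \<le> (LINT t|lborel. ?D t + ?D (t - w))"
      by (rule integral_mono') (use D D' le in auto)
    also have "\<dots> = (LINT t|lborel. ?D t) + (LINT t|lborel. ?D (t - w))"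
      using D D' by simp
    also have "(LINT t|lborel. ?D (t - w)) = (LINT t|lborel. ?D t)"
      using lborel_integral_real_affine[of 1 ?D "- w"] by simp
    also have "(LINT t|lborel. ?D t) = measure lborel (U - K)"
      by simp
    also have "measure lborel (U - K) \<le> 2 * \<eta>"
      using UK \<eta> by (auto simp: measure_def intro!: enn2real_leI)
    finally show "(LINT t|lborel. \<bar>indicator B (t - w) - indicator B t\<bar> :: real) < e"
      using \<eta> e by (simp add: \<eta>_def)
  qed
qed

text \<open>
  The measure of the intersection of \<open>A\<close> with \<open>B\<close> translated by \<open>w\<close>, written as an integral of
  indicators so that Fubini applies directly. Its values are complex because it is the argument of
  \<open>fourier\<close>.
\<close>

definition set_correlation :: "real set \<Rightarrow> real set \<Rightarrow> real \<Rightarrow> complex"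
  where "set_correlation A B w = (LINT t|lborel. indicator A t * indicator B (t - w))"

context
  fixes A B :: "real set"
  assumes A: "A \<in> sets borel" "emeasure lborel A < \<infinity>"
    and B: "B \<in> sets borel" "emeasure lborel B < \<infinity>"
begin

lemma integrable_pair_indicator:
  "integrable (lborel \<Otimes>\<^sub>M lborel)
    (\<lambda>(t, w). indicator A t * indicator B (t - w) * iexp (- (\<tau> * w)))"
proof (rule lborel_pair.Fubini_integrable)
  note [measurable] = A(1) B(1)
  have iA: "integrable lborel (indicator A :: real \<Rightarrow> real)"
    using A by (intro integrable_real_indicator) auto
  have iB: "integrable lborel (indicator B :: real \<Rightarrow> real)"
    using B by (intro integrable_real_indicator) auto
  have shift: "integrable lborel (\<lambda>w. indicator B (t - w) :: real)" for t
    using lborel_integrable_real_affine[OF iB, of "-1" t] by simp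
  have shift': "(LINT w|lborel. indicator B (t - w)) = measure lborel B" for t
    using lborel_integral_real_affine[of "-1" "indicator B :: real \<Rightarrow> real" t] by simp
  show "(\<lambda>(t, w). indicator A t * indicator B (t - w) * iexp (- (\<tau> * w)))
      \<in> borel_measurable (lborel \<Otimes>\<^sub>M lborel)"
    by measurable
  have norm_eq: "norm (indicator A t * indicator B (t - w) * iexp (- (\<tau> * w))) =
      indicator A t * indicator B (t - w)" for t w
    by (simp add: norm_mult indicator_def)
  show "integrable lborel (\<lambda>t. LINT w|lborel. norm (case (t, w) of (t, w) \<Rightarrow>
      indicator A t * indicator B (t - w) * iexp (- (\<tau> * w))))"
    unfolding prod.case norm_eq using iA by (simp add: shift')
  show "AE t in lborel. integrable lborel (\<lambda>w. case (t, w) of (t, w) \<Rightarrow>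
      indicator A t * indicator B (t - w) * iexp (- (\<tau> * w)))"
  proof (intro AE_I2)
    fix t
    show "integrable lborel (\<lambda>w. case (t, w) of (t, w) \<Rightarrow>
        indicator A t * indicator B (t - w) * iexp (- (\<tau> * w)))"
      unfolding prod.case
      by (rule Bochner_Integration.integrable_bound[OF shift[of t]])
        (auto simp: norm_mult indicator_def)
  qed
qed

lemma set_correlation_eq:
  "set_correlation A B w * iexp (- (\<tau> * w)) =
    (LINT t|lborel. indicator A t * indicator B (t - w) * iexp (- (\<tau> * w)))"
  unfolding set_correlation_def by (rule integral_mult_left_zero[symmetric])

lemma integrable_set_correlation: "integrable lborel (set_correlation A B)"
  using lborel_pair.integrable_snd[OF integrable_pair_indicator[of 0]]
  by (simp add: set_correlation_def[abs_def])

lemma norm_set_correlation_le: "norm (set_correlation A B w) \<le> measure lborel A"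
proof -
  have iA: "integrable lborel (indicator A :: real \<Rightarrow> real)"
    using A by (intro integrable_real_indicator) auto
  have "norm (set_correlation A B w) \<le> (LINT t|lborel. norm (indicator A t * indicator B (t - w) :: complex))"
    unfolding set_correlation_def by (rule integral_norm_bound)
  also have "\<dots> \<le> (LINT t|lborel. indicator A t)"
    by (rule integral_mono'[OF iA]) (auto simp: norm_mult indicator_def)
  finally show ?thesis
    by simp
qed

lemma set_correlation_0: "set_correlation A B 0 = of_real (measure lborel (A \<inter> B))"
proof -
  have "(\<lambda>t. indicator A t * indicator B (t - 0)) = (\<lambda>t. complex_of_real (indicator (A \<inter> B) t))"
    by (auto simp: indicator_def fun_eq_iff)
  then show ?thesis
    unfolding set_correlation_def by simp
qed

lemma isCont_set_correlation: "isCont (set_correlation A B) 0"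
proof -
  note [measurable] = A(1) B(1)
  have iB: "integrable lborel (indicator B :: real \<Rightarrow> real)"
    using B by (intro integrable_real_indicator) auto
  have shift: "integrable lborel (\<lambda>t. indicator B (t - w) :: real)" for w
    using lborel_integrable_real_affine[OF iB, of 1 "- w"] by simp
  have int: "integrable lborel (\<lambda>t. indicator A t * indicator B (t - w) :: complex)" for w
    by (rule Bochner_Integration.integrable_bound[OF shift[of w]]) (auto simp: norm_mult indicator_def)
  have "\<exists>\<delta>>0. \<forall>w. \<bar>w\<bar> < \<delta> \<longrightarrow> norm (set_correlation A B w - set_correlation A B 0) < e" if "e > 0" for e
  proof -
    obtain \<delta> where \<delta>: "\<delta> > 0" "\<And>w. \<bar>w\<bar> < \<delta> \<Longrightarrow>
        (LINT t|lborel. \<bar>indicator B (t - w) - indicator B t\<bar> :: real) < e"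
      using tendsto_translate_indicator[OF B \<open>e > 0\<close>] by blast
    have "norm (set_correlation A B w - set_correlation A B 0) < e" if w: "\<bar>w\<bar> < \<delta>" for w
    proof -
      have "set_correlation A B w - set_correlation A B 0 =
          (LINT t|lborel. indicator A t * indicator B (t - w) - indicator A t * indicator B (t - 0))"
        unfolding set_correlation_def using int[of w] int[of 0]
        by (intro Bochner_Integration.integral_diff[symmetric])
      also have "norm \<dots> \<le> (LINT t|lborel. norm (indicator A t * indicator B (t - w) -
          indicator A t * indicator B (t - 0) :: complex))"
        by (rule integral_norm_bound)
      also have "\<dots> \<le> (LINT t|lborel. \<bar>indicator B (t - w) - indicator B t\<bar> :: real)"
      proof (rule integral_mono')
        show "integrable lborel (\<lambda>t. \<bar>indicator B (t - w) - indicator B t\<bar> :: real)"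
          by (intro integrable_abs Bochner_Integration.integrable_diff shift iB)
      qed (auto simp: indicator_def)
      also have "\<dots> < e"
        by (rule \<delta>(2)[OF w])
      finally show ?thesis .
    qed
    then show ?thesis
      using \<delta>(1) by blast
  qed
  then show ?thesis
    unfolding continuous_at_eps_delta by (simp add: dist_norm)
qed

text \<open>
  The correlation theorem. In the second factor the variable \<open>u\<close> is replaced by \<open>t - w\<close> for each
  \<open>t\<close> separately; the dependence of the exponentials on \<open>t\<close> then cancels.
\<close>

lemma fourier_set_correlation:
  "fourier (indicator A) \<tau> * cnj (fourier (indicator B) \<tau>) = fourier (set_correlation A B) \<tau>"
proof -
  have reflect: "cnj (fourier (indicator B) \<tau>) =
      iexp (\<tau> * t) * (LINT w|lborel. indicator B (t - w) * iexp (- (\<tau> * w)))" for t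
  proof -
    have "cnj (fourier (indicator B) \<tau>) = (LINT u|lborel. indicator B u * iexp (\<tau> * u))"
      unfolding fourier_def Bochner_Integration.integral_cnj[symmetric]
      by (intro Bochner_Integration.integral_cong) (auto simp: exp_cnj indicator_def)
    also have "\<dots> = (LINT w|lborel. indicator B (t - w) * iexp (\<tau> * (t - w)))"
      by (subst lborel_integral_real_affine[of "-1" _ t]) auto
    also have "\<dots> = (LINT w|lborel. iexp (\<tau> * t) * (indicator B (t - w) * iexp (- (\<tau> * w))))"
      by (intro Bochner_Integration.integral_cong)
        (auto simp: right_diff_distrib exp_diff exp_minus divide_inverse ac_simps)
    finally show ?thesis
      by simp
  qed
  have "fourier (indicator A) \<tau> * cnj (fourier (indicator B) \<tau>) =
      (LINT t|lborel. indicator A t * iexp (- (\<tau> * t)) * cnj (fourier (indicator B) \<tau>))"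
    unfolding fourier_def[of "indicator A"] by (rule integral_mult_left_zero[symmetric])
  also have "\<dots> = (LINT t|lborel. LINT w|lborel. indicator A t * indicator B (t - w) * iexp (- (\<tau> * w)))"
  proof (rule Bochner_Integration.integral_cong)
    fix t
    have "iexp (- (\<tau> * t)) * iexp (\<tau> * t) = 1"
      by (simp flip: exp_add)
    then have "indicator A t * iexp (- (\<tau> * t)) * cnj (fourier (indicator B) \<tau>) =
        indicator A t * (LINT w|lborel. indicator B (t - w) * iexp (- (\<tau> * w)))"
      unfolding reflect[of t] by (metis (no_types, lifting) mult.assoc mult.right_neutral)
    also have "\<dots> = (LINT w|lborel. indicator A t * (indicator B (t - w) * iexp (- (\<tau> * w))))"
      by (rule integral_mult_right_zero[symmetric])
    finally show "indicator A t * iexp (- (\<tau> * t)) * cnj (fourier (indicator B) \<tau>) =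
        (LINT w|lborel. indicator A t * indicator B (t - w) * iexp (- (\<tau> * w)))"
      by (simp only: mult.assoc)
  qed simp
  also have "\<dots> = (LINT w|lborel. LINT t|lborel. indicator A t * indicator B (t - w) * iexp (- (\<tau> * w)))"
    by (rule lborel_pair.Fubini_integral[OF integrable_pair_indicator, symmetric])
  also have "\<dots> = fourier (set_correlation A B) \<tau>"
    unfolding fourier_def set_correlation_eq ..
  finally show ?thesis .
qed

lemma Gauss_summation_indicator:
  "(\<lambda>n. LINT \<tau>|lborel. std_normal_density (\<tau> / real (Suc n)) *\<^sub>R
      (fourier (indicator A) \<tau> * cnj (fourier (indicator B) \<tau>)))
    \<longlonglongrightarrow> of_real (sqrt (2 * pi) * measure lborel (A \<inter> B))"
  using Gauss_summation_fourier[OF integrable_set_correlation norm_set_correlation_le isCont_set_correlation]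
  by (simp add: fourier_set_correlation set_correlation_0 scaleR_conv_of_real del: of_nat_Suc)

end

lemma borel_measurable_fourier [measurable]:
  assumes [measurable]: "m \<in> borel_measurable borel"
  shows "fourier m \<in> borel_measurable borel"
  unfolding fourier_def[abs_def] by measurable

lemma std_normal_density_le: "std_normal_density x \<le> std_normal_density 0"
  by (simp add: std_normal_density_def divide_right_mono)

lemma std_normal_density_scaled_tendsto:
  "(\<lambda>n. std_normal_density (\<tau> / real (Suc n))) \<longlonglongrightarrow> std_normal_density 0"
proof -
  have "isCont std_normal_density 0"
    unfolding std_normal_density_def[abs_def] by (intro continuous_intros) auto
  moreover have "(\<lambda>n. \<tau> / real (Suc n)) \<longlonglongrightarrow> 0"
    using tendsto_mult[OF tendsto_const[of \<tau>] LIMSEQ_inverse_real_of_nat] by (simp add: divide_inverse)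
  ultimately show ?thesis
    by (rule isCont_tendsto_compose)
qed

text \<open>
  For \<open>A = B\<close> the Gaussian means of the squared modulus increase as the Gaussian flattens, and
  they converge by \<open>Gauss_summation_indicator\<close>. Monotone convergence gives integrability.
\<close>

lemma integrable_norm_fourier_indicator:
  assumes A: "A \<in> sets borel" "emeasure lborel A < \<infinity>"
  shows "integrable lborel (\<lambda>\<tau>. (norm (fourier (indicator A) \<tau>))\<^sup>2)"
proof -
  note [measurable] = A(1)
  let ?F = "\<lambda>\<tau>. (norm (fourier (indicator A) \<tau>))\<^sup>2"
  have [measurable]: "fourier (indicator A) \<in> borel_measurable borel"
    by measurable
  have bound: "norm (fourier (indicator A) \<tau>) \<le> measure lborel A" for \<tau>
  proof -
    have "norm (fourier (indicator A) \<tau>) \<le> (LINT t|lborel. norm (indicator A t * iexp (- (\<tau> * t))))"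
      unfolding fourier_def by (rule integral_norm_bound)
    also have "\<dots> = (LINT t|lborel. indicator A t)"
      by (intro Bochner_Integration.integral_cong) (auto simp: norm_mult indicator_def)
    finally show ?thesis
      by simp
  qed
  define f where "f n \<tau> = std_normal_density (\<tau> / real (Suc n)) * ?F \<tau>" for n \<tau>
  have f: "integrable lborel (f n)" for n
    unfolding f_def
  proof (rule Bochner_Integration.integrable_bound)
    show "integrable lborel (\<lambda>\<tau>. std_normal_density (inverse (real (Suc n)) * \<tau>) * (measure lborel A)\<^sup>2)"
      by (intro integrable_mult_left integrable_std_normal_density_scaled) simp
    show "AE \<tau> in lborel. norm (std_normal_density (\<tau> / real (Suc n)) * ?F \<tau>)
        \<le> norm (std_normal_density (inverse (real (Suc n)) * \<tau>) * (measure lborel A)\<^sup>2)"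
      using power_mono[OF bound norm_ge_zero, of _ 2] by (intro AE_I2)
        (auto simp: abs_mult divide_inverse mult.commute[of "inverse _"] simp del: of_nat_Suc intro!: mult_left_mono)
  qed measurable
  have "of_real (f n \<tau>) = std_normal_density (\<tau> / real (Suc n)) *\<^sub>R
      (fourier (indicator A) \<tau> * cnj (fourier (indicator A) \<tau>))" for n \<tau>
    unfolding f_def scaleR_conv_of_real of_real_mult complex_norm_square ..
  with Gauss_summation_indicator[OF A A]
  have "(\<lambda>n. LINT \<tau>|lborel. complex_of_real (f n \<tau>)) \<longlonglongrightarrow> of_real (sqrt (2 * pi) * measure lborel A)"
    by simp
  then have lim: "(\<lambda>n. LINT \<tau>|lborel. f n \<tau>) \<longlonglongrightarrow> sqrt (2 * pi) * measure lborel A"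
    unfolding integral_complex_of_real tendsto_of_real_iff .
  have "integrable lborel (\<lambda>\<tau>. std_normal_density 0 * ?F \<tau>)"
  proof (rule integrable_monotone_convergence[OF f _ _ lim])
    show "AE \<tau> in lborel. mono (\<lambda>n. f n \<tau>)"
    proof (intro AE_I2 incseq_SucI)
      fix \<tau> n
      have "(\<tau> / real (Suc (Suc n)))\<^sup>2 \<le> (\<tau> / real (Suc n))\<^sup>2"
        by (auto simp: power_divide intro!: divide_left_mono power_mono)
      then show "f n \<tau> \<le> f (Suc n) \<tau>"
        unfolding f_def std_normal_density_def by (intro mult_right_mono mult_left_mono) auto
    qed
    show "AE \<tau> in lborel. (\<lambda>n. f n \<tau>) \<longlonglongrightarrow> std_normal_density 0 * ?F \<tau>"
      unfolding f_def by (intro AE_I2 tendsto_mult std_normal_density_scaled_tendsto tendsto_const)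
  qed measurable
  then have "integrable lborel (\<lambda>\<tau>. sqrt (2 * pi) * (std_normal_density 0 * ?F \<tau>))"
    by (rule integrable_mult_right)
  then show ?thesis
    by (simp add: std_normal_density_def)
qed

text \<open>
  Now the product of two transforms has the integrable majorant \<open>w\<close>, so the Gaussian factor can be
  removed by dominated convergence. The correlation at \<open>0\<close> is the measure of \<open>A \<inter> B\<close>, whence the
  right-hand side.
\<close>

proposition Plancherel_indicator:
  assumes A: "A \<in> sets borel" "emeasure lborel A < \<infinity>"
    and B: "B \<in> sets borel" "emeasure lborel B < \<infinity>"
  shows "has_bochner_integral lborel (\<lambda>\<tau>. fourier (indicator A) \<tau> * cnj (fourier (indicator B) \<tau>))
    (of_real (2 * pi * measure lborel (A \<inter> B)))"
proof -
  note [measurable] = A(1) B(1)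
  have [measurable]: "fourier (indicator A) \<in> borel_measurable borel"
    "fourier (indicator B) \<in> borel_measurable borel"
    by measurable
  let ?P = "\<lambda>\<tau>. fourier (indicator A) \<tau> * cnj (fourier (indicator B) \<tau>)"
  define w where "w \<tau> = (norm (fourier (indicator A) \<tau>))\<^sup>2 + (norm (fourier (indicator B) \<tau>))\<^sup>2" for \<tau>
  have w: "integrable lborel w"
    unfolding w_def using A B by (intro Bochner_Integration.integrable_add integrable_norm_fourier_indicator)
  have bound: "norm (?P \<tau>) \<le> w \<tau>" for \<tau>
  proof -
    have "norm (?P \<tau>) \<le> 2 * norm (fourier (indicator A) \<tau>) * norm (fourier (indicator B) \<tau>)"
      by (simp add: norm_mult)
    also have "\<dots> \<le> w \<tau>"
      unfolding w_def by (rule sum_squares_bound)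
    finally show ?thesis .
  qed
  have w_nonneg: "w \<tau> \<ge> 0" for \<tau>
    by (simp add: w_def)
  have "cnj \<in> borel_measurable borel"
    by (intro borel_measurable_continuous_onI continuous_intros)
  then have [measurable]: "?P \<in> borel_measurable borel"
    by measurable
  have P: "integrable lborel ?P"
    by (rule Bochner_Integration.integrable_bound[OF w]) (use bound w_nonneg in auto)
  have "(\<lambda>n. LINT \<tau>|lborel. std_normal_density (\<tau> / real (Suc n)) *\<^sub>R ?P \<tau>)
      \<longlonglongrightarrow> (LINT \<tau>|lborel. std_normal_density 0 *\<^sub>R ?P \<tau>)"
  proof (rule integral_dominated_convergence)
    show "integrable lborel (\<lambda>\<tau>. std_normal_density 0 * w \<tau>)"
      using w by simp
    show "AE \<tau> in lborel. (\<lambda>n. std_normal_density (\<tau> / real (Suc n)) *\<^sub>R ?P \<tau>)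
        \<longlonglongrightarrow> std_normal_density 0 *\<^sub>R ?P \<tau>"
      by (intro AE_I2 tendsto_scaleR std_normal_density_scaled_tendsto tendsto_const)
    show "AE \<tau> in lborel. norm (std_normal_density (\<tau> / real (Suc n)) *\<^sub>R ?P \<tau>)
        \<le> std_normal_density 0 * w \<tau>" for n
      using bound w_nonneg unfolding norm_scaleR real_norm_def abs_of_nonneg[OF normal_density_nonneg]
      by (intro AE_I2 mult_mono std_normal_density_le) auto
  qed measurable
  from LIMSEQ_unique[OF this Gauss_summation_indicator[OF A B]]
  have "std_normal_density 0 *\<^sub>R (LINT \<tau>|lborel. ?P \<tau>) = of_real (sqrt (2 * pi) * measure lborel (A \<inter> B))"
    by simp
  then have "(1 / sqrt (2 * pi)) *\<^sub>R (LINT \<tau>|lborel. ?P \<tau>) = (sqrt (2 * pi) * measure lborel (A \<inter> B)) *\<^sub>R 1"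
    by (simp add: std_normal_density_def scaleR_conv_of_real)
  then have "sqrt (2 * pi) *\<^sub>R (1 / sqrt (2 * pi)) *\<^sub>R (LINT \<tau>|lborel. ?P \<tau>) =
      sqrt (2 * pi) *\<^sub>R (sqrt (2 * pi) * measure lborel (A \<inter> B)) *\<^sub>R 1"
    by (rule arg_cong)
  then have "(LINT \<tau>|lborel. ?P \<tau>) = of_real (2 * pi * measure lborel (A \<inter> B))"
    unfolding scaleR_scaleR by (simp add: scaleR_conv_of_real flip: of_real_mult mult.assoc)
  then show ?thesis
    using P by (simp add: has_bochner_integral_iff)
qed

section \<open>Plancherel's theorem for Hilbert space valued functions\<close>

lemma borel_measurable_lebesgue_on:
  "f \<in> borel_measurable borel \<Longrightarrow> f \<in> borel_measurable (lebesgue_on S)"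
  by (intro measurable_restrict_space1 measurable_completion) simp

definition strong_fourier :: "real measure \<Rightarrow> (real \<Rightarrow> 'v::chilbert_space) \<Rightarrow> real \<Rightarrow> 'v"
  where "strong_fourier M g \<tau> = strong_integral M (\<lambda>t. iexp (- (\<tau> * t)) *\<^sub>C g t)"

context
  fixes S :: "real set"
  assumes S: "S \<in> sets lebesgue"
begin

interpretation complete_measure "lebesgue_on S"
  using S by (rule complete_measure_lebesgue_on)

text \<open>
  The results of the previous section concern Borel sets, where the product measure is available.
  A Lebesgue measurable set is replaced by its Borel part, from which it differs by a null set.
\<close>

lemma lebesgue_on_indicator_eq_fourier:
  assumes A: "A \<in> sets (lebesgue_on S)"
  shows "(LINT t|lebesgue_on S. indicator A t * iexp (- (\<tau> * t))) = fourier (indicator (main_part lborel A)) \<tau>"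
proof -
  have AS: "A \<subseteq> S" and Al: "A \<in> sets lebesgue"
    using A S by (auto simp: sets_restrict_space_iff)
  have [measurable]: "main_part lborel A \<in> sets borel"
    using main_part_sets[OF Al] by simp
  have e: "(\<lambda>t. iexp (- (\<tau> * t))) \<in> borel_measurable lborel"
    by measurable
  have m: "(\<lambda>t. indicator A t * iexp (- (\<tau> * t))) \<in> borel_measurable lebesgue"
    using Al e by (intro borel_measurable_times borel_measurable_indicator measurable_completion)
  have b: "(\<lambda>t. indicator (main_part lborel A) t * iexp (- (\<tau> * t))) \<in> borel_measurable lborel"
    by measurable
  have "(LINT t|lebesgue_on S. indicator A t * iexp (- (\<tau> * t))) =
      (LINT t|lebesgue. indicator S t *\<^sub>R (indicator A t * iexp (- (\<tau> * t))))"
    using S by (intro integral_restrict_space) auto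
  also have "\<dots> = (LINT t|lebesgue. indicator A t * iexp (- (\<tau> * t)))"
    using AS by (intro Bochner_Integration.integral_cong) (auto simp: indicator_def)
  also have "\<dots> = (LINT t|lebesgue. indicator (main_part lborel A) t * iexp (- (\<tau> * t)))"
  proof (rule integral_cong_AE[OF m measurable_completion[OF b]])
    show "AE t in lebesgue. indicator A t * iexp (- (\<tau> * t)) =
        indicator (main_part lborel A) t * iexp (- (\<tau> * t))"
      using AE_completion[OF AE_in_main_part[OF Al]] by eventually_elim (simp add: indicator_def)
  qed
  also have "\<dots> = fourier (indicator (main_part lborel A)) \<tau>"
    unfolding fourier_def by (rule integral_completion[OF b])
  finally show ?thesis .
qed

lemma Plancherel_lebesgue_on_indicator:
  assumes A: "A \<in> sets (lebesgue_on S)" "emeasure (lebesgue_on S) A < \<infinity>"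
    and B: "B \<in> sets (lebesgue_on S)" "emeasure (lebesgue_on S) B < \<infinity>"
  shows "has_bochner_integral lborel
    (\<lambda>\<tau>. (LINT t|lebesgue_on S. indicator A t * iexp (- (\<tau> * t))) *
      cnj (LINT t|lebesgue_on S. indicator B t * iexp (- (\<tau> * t))))
    (of_real (2 * pi * measure (lebesgue_on S) (A \<inter> B)))"
proof -
  have AS: "A \<subseteq> S" and Al: "A \<in> sets lebesgue" and BS: "B \<subseteq> S" and Bl: "B \<in> sets lebesgue"
    using A B S by (auto simp: sets_restrict_space_iff)
  have em: "emeasure (lebesgue_on S) X = emeasure lborel (main_part lborel X)"
    if "X \<in> sets lebesgue" "X \<subseteq> S" for X
    using that S by (simp add: emeasure_restrict_space)
  have "measure (lebesgue_on S) (A \<inter> B) = measure lebesgue (A \<inter> B)"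
    using AS S by (intro measure_restrict_space) auto
  also have "\<dots> = measure lebesgue (main_part lborel A \<inter> main_part lborel B)"
  proof (rule measure_eq_AE)
    show "AE x in lebesgue. (x \<in> A \<inter> B) = (x \<in> main_part lborel A \<inter> main_part lborel B)"
      using AE_completion[OF AE_in_main_part[OF Al]] AE_completion[OF AE_in_main_part[OF Bl]]
      by eventually_elim simp
  qed (use Al Bl main_part_sets[OF Al] main_part_sets[OF Bl] in auto)
  also have "\<dots> = measure lborel (main_part lborel A \<inter> main_part lborel B)"
    using main_part_sets[OF Al] main_part_sets[OF Bl] by (intro measure_completion) auto
  finally have meas: "measure (lebesgue_on S) (A \<inter> B) = \<dots>" .
  show ?thesis
    unfolding lebesgue_on_indicator_eq_fourier[OF A(1)] lebesgue_on_indicator_eq_fourier[OF B(1)] meas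
    using main_part_sets[OF Al] main_part_sets[OF Bl] A(2) B(2) em[OF Al AS] em[OF Bl BS]
    by (intro Plancherel_indicator) auto
qed

lemma strongly_integrable_fourier:
  fixes g :: "real \<Rightarrow> 'v::chilbert_space"
  assumes "strongly_integrable (lebesgue_on S) g"
  shows "strongly_integrable (lebesgue_on S) (\<lambda>t. iexp (- (\<tau> * t)) *\<^sub>C g t)"
proof -
  have "(\<lambda>t. iexp (- (\<tau> * t))) \<in> borel_measurable (lebesgue_on S)"
    by (rule borel_measurable_lebesgue_on) measurable
  then show ?thesis
    using assms by (simp add: strongly_integrable_def strongly_measurable_scaleC norm_scaleC)
qed

lemma strong_fourier_diff:
  fixes f g :: "real \<Rightarrow> 'v::chilbert_space"
  assumes "strongly_integrable (lebesgue_on S) f" "strongly_integrable (lebesgue_on S) g"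
  shows "strong_fourier (lebesgue_on S) (\<lambda>t. f t - g t) \<tau> =
    strong_fourier (lebesgue_on S) f \<tau> - strong_fourier (lebesgue_on S) g \<tau>"
  unfolding strong_fourier_def scaleC_diff_right
  by (intro strong_integral_diff strongly_integrable_fourier assms)

lemma norm_strong_fourier_le:
  fixes g :: "real \<Rightarrow> 'v::chilbert_space"
  assumes "strongly_integrable (lebesgue_on S) g"
  shows "norm (strong_fourier (lebesgue_on S) g \<tau>) \<le> (LINT t|lebesgue_on S. norm (g t))"
  using norm_strong_integral_le[OF strongly_integrable_fourier[OF assms]]
  by (simp add: strong_fourier_def norm_scaleC)

text \<open>
  Write \<open>h\<close> as a finite combination of its nonzero values \<open>c\<close> with indicators of the sets \<open>A c\<close>.
  The squared norms of \<open>h\<close> and of its transform both expand into double sums over pairs of values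
  with the same coefficients \<open>cinner c d\<close>, and Plancherel's identity for \<open>A c\<close> and \<open>A d\<close> matches
  them term by term. The value zero is left out since its level set may have infinite measure.
\<close>

lemma Plancherel_simple_function:
  fixes h :: "real \<Rightarrow> 'v::chilbert_space"
  assumes h: "simple_function (lebesgue_on S) h" and int: "integrable (lebesgue_on S) (\<lambda>t. norm (h t))"
  shows "has_bochner_integral lborel (\<lambda>\<tau>. (norm (strong_fourier (lebesgue_on S) h \<tau>))\<^sup>2)
    (2 * pi * (LINT t|lebesgue_on S. (norm (h t))\<^sup>2))"
proof -
  define M where "M = lebesgue_on S"
  define R where "R = h ` S - {0}"
  define A where "A c = h -` {c} \<inter> S" for c
  define hat where "hat c \<tau> = (LINT t|M. indicator (A c) t * iexp (- (\<tau> * t)))" for c \<tau>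
  have space: "space M = S"
    by (simp add: M_def)
  have fin: "finite R"
    using simple_functionD(1)[OF h] by (simp add: R_def)
  have As: "A c \<in> sets M" for c
    using simple_functionD(2)[OF h, of "{c}"] by (simp add: A_def M_def)
  have "(\<integral>\<^sup>+t. ennreal (norm (h t)) \<partial>M) < \<infinity>"
    using nn_integral_eq_integral[OF int] by (simp add: M_def)
  then have supp: "emeasure M {t \<in> space M. ennreal (norm (h t)) \<noteq> 0} \<noteq> \<infinity>"
    by (intro simple_function_finite_support simple_function_compose1[OF h[folded M_def]]) auto
  have Afin: "emeasure M (A c) < \<infinity>" if "c \<in> R" for c
  proof -
    have "emeasure M (A c) \<le> emeasure M {t \<in> space M. ennreal (norm (h t)) \<noteq> 0}"
    proof (rule emeasure_mono)
      show "A c \<subseteq> {t \<in> space M. ennreal (norm (h t)) \<noteq> 0}"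
        using that by (auto simp: A_def R_def space)
      show "{t \<in> space M. ennreal (norm (h t)) \<noteq> 0} \<in> sets M"
        using borel_measurable_simple_function[OF simple_function_compose1[OF h[folded M_def], of "\<lambda>x. ennreal (norm x)"]]
        by measurable
    qed
    with supp show ?thesis
      by (auto simp: top.not_eq_extremum)
  qed
  have indic: "has_bochner_integral M (\<lambda>t. indicator (A c) t * iexp (- (\<tau> * t))) (hat c \<tau>)" if "c \<in> R" for c \<tau>
  proof -
    have "integrable M (indicator (A c) :: real \<Rightarrow> real)"
      using As Afin[OF that] by (intro integrable_real_indicator)
    moreover have "(\<lambda>t. indicator (A c) t * iexp (- (\<tau> * t))) \<in> borel_measurable M"
    proof -
      have "(\<lambda>t. iexp (- (\<tau> * t))) \<in> borel_measurable borel"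
        by measurable
      then show ?thesis
        using As[of c] unfolding M_def
        by (intro borel_measurable_times borel_measurable_indicator borel_measurable_lebesgue_on)
    qed
    ultimately have "integrable M (\<lambda>t. indicator (A c) t * iexp (- (\<tau> * t)))"
      by (rule Bochner_Integration.integrable_bound) (auto simp: norm_mult indicator_def)
    then show ?thesis
      by (simp add: has_bochner_integral_iff hat_def)
  qed
  have expand: "h t = (\<Sum>c\<in>R. (indicator (A c) t :: complex) *\<^sub>C c)" if "t \<in> S" for t
  proof -
    have "(\<Sum>c\<in>R. (indicator (A c) t :: complex) *\<^sub>C c) = (\<Sum>c\<in>R. if c = h t then c else 0)"
      using that by (intro sum.cong) (auto simp: A_def indicator_def)
    also have "\<dots> = h t"
      using that fin by (auto simp: sum.delta R_def)
    finally show ?thesis ..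
  qed
  have transform: "strong_fourier M h \<tau> = (\<Sum>c\<in>R. hat c \<tau> *\<^sub>C c)" for \<tau>
    unfolding strong_fourier_def M_def
  proof (rule strong_integral_eqI)
    show "strongly_integrable (lebesgue_on S) (\<lambda>t. iexp (- (\<tau> * t)) *\<^sub>C h t)"
      using h int by (intro strongly_integrable_fourier)
        (simp add: strongly_integrable_def strongly_measurable_simple_function)
    fix v
    have "has_bochner_integral M (\<lambda>t. \<Sum>c\<in>R. indicator (A c) t * iexp (- (\<tau> * t)) * cinner c v)
        (\<Sum>c\<in>R. hat c \<tau> * cinner c v)"
      by (intro has_bochner_integral_sum has_bochner_integral_mult_left indic)
    also have "(\<Sum>c\<in>R. hat c \<tau> * cinner c v) = cinner (\<Sum>c\<in>R. hat c \<tau> *\<^sub>C c) v"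
      by (simp add: cinner_sum_left cinner_scaleC_left)
    also have "has_bochner_integral M (\<lambda>t. \<Sum>c\<in>R. indicator (A c) t * iexp (- (\<tau> * t)) * cinner c v) \<dots> \<longleftrightarrow>
        has_bochner_integral M (\<lambda>t. cinner (iexp (- (\<tau> * t)) *\<^sub>C h t) v) \<dots>"
    proof (rule has_bochner_integral_cong)
      fix t assume "t \<in> space M"
      then have "t \<in> S"
        by (simp add: space)
      show "(\<Sum>c\<in>R. indicator (A c) t * iexp (- (\<tau> * t)) * cinner c v) = cinner (iexp (- (\<tau> * t)) *\<^sub>C h t) v"
        unfolding expand[OF \<open>t \<in> S\<close>]
        by (simp add: cinner_scaleC_left cinner_sum_left sum_distrib_left ac_simps)
    qed auto
    finally show "has_bochner_integral (lebesgue_on S) (\<lambda>t. cinner (iexp (- (\<tau> * t)) *\<^sub>C h t) v)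
        (cinner (\<Sum>c\<in>R. hat c \<tau> *\<^sub>C c) v)"
      unfolding M_def .
  qed
  have freq: "has_bochner_integral lborel (\<lambda>\<tau>. complex_of_real ((norm (strong_fourier M h \<tau>))\<^sup>2))
      (\<Sum>c\<in>R. \<Sum>d\<in>R. of_real (2 * pi * measure M (A c \<inter> A d)) * cinner c d)"
  proof -
    have "complex_of_real ((norm (strong_fourier M h \<tau>))\<^sup>2) =
        (\<Sum>c\<in>R. \<Sum>d\<in>R. (hat c \<tau> * cnj (hat d \<tau>)) * cinner c d)" for \<tau>
      unfolding cinner_self[symmetric, where 'a = 'v] transform cinner_sum_left
      unfolding cinner_sum_right cinner_scaleC_left cinner_scaleC_right by (simp add: ac_simps)
    moreover have "has_bochner_integral lborel (\<lambda>\<tau>. \<Sum>c\<in>R. \<Sum>d\<in>R. (hat c \<tau> * cnj (hat d \<tau>)) * cinner c d)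
        (\<Sum>c\<in>R. \<Sum>d\<in>R. of_real (2 * pi * measure M (A c \<inter> A d)) * cinner c d)"
      unfolding hat_def M_def
      by (intro has_bochner_integral_sum has_bochner_integral_mult_left Plancherel_lebesgue_on_indicator
          As[unfolded M_def] Afin[unfolded M_def])
    ultimately show ?thesis
      by simp
  qed
  have time: "has_bochner_integral M (\<lambda>t. complex_of_real ((norm (h t))\<^sup>2))
      (\<Sum>c\<in>R. \<Sum>d\<in>R. of_real (measure M (A c \<inter> A d)) * cinner c d)"
  proof -
    have "has_bochner_integral M (\<lambda>t. \<Sum>c\<in>R. \<Sum>d\<in>R. of_real (indicator (A c \<inter> A d) t) * cinner c d)
        (\<Sum>c\<in>R. \<Sum>d\<in>R. of_real (measure M (A c \<inter> A d)) * cinner c d)"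
    proof (intro has_bochner_integral_sum has_bochner_integral_mult_left has_bochner_integral_of_real
        has_bochner_integral_real_indicator)
      fix c d assume "c \<in> R"
      show "A c \<inter> A d \<in> sets M"
        using As by auto
      have "emeasure M (A c \<inter> A d) \<le> emeasure M (A c)"
        using As by (intro emeasure_mono) auto
      then show "emeasure M (A c \<inter> A d) < \<infinity>"
        using Afin[OF \<open>c \<in> R\<close>] by (rule order_le_less_trans)
    qed
    moreover have "complex_of_real ((norm (h t))\<^sup>2) =
        (\<Sum>c\<in>R. \<Sum>d\<in>R. of_real (indicator (A c \<inter> A d) t) * cinner c d)" if "t \<in> space M" for t
    proof -
      have t: "t \<in> S"
        using that by (simp add: space)
      have "cinner (h t) (h t) = (\<Sum>c\<in>R. \<Sum>d\<in>R. (indicator (A c) t * indicator (A d) t) * cinner c d)"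
      proof -
        have "cinner (\<Sum>c\<in>R. (indicator (A c) t :: complex) *\<^sub>C c) (\<Sum>c\<in>R. (indicator (A c) t :: complex) *\<^sub>C c) =
            (\<Sum>c\<in>R. \<Sum>d\<in>R. (indicator (A c) t * indicator (A d) t) * cinner c d)"
          unfolding cinner_sum_left
          unfolding cinner_sum_right cinner_scaleC_left cinner_scaleC_right
          by (intro sum.cong) (auto simp: indicator_def)
        then show ?thesis
          unfolding expand[OF t, symmetric] .
      qed
      then show ?thesis
        unfolding cinner_self indicator_inter_arith of_real_mult of_real_indicator .
    qed
    ultimately show ?thesis
      by (subst has_bochner_integral_cong[OF refl _ refl]) auto
  qed
  have "complex_of_real (LINT t|M. (norm (h t))\<^sup>2) = (\<Sum>c\<in>R. \<Sum>d\<in>R. of_real (measure M (A c \<inter> A d)) * cinner c d)"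
    using has_bochner_integral_integral_eq[OF time] unfolding integral_complex_of_real .
  then have "(\<Sum>c\<in>R. \<Sum>d\<in>R. of_real (2 * pi * measure M (A c \<inter> A d)) * cinner c d) =
      complex_of_real (2 * pi * (LINT t|M. (norm (h t))\<^sup>2))"
    by (simp add: sum_distrib_left mult.assoc)
  with freq have "has_bochner_integral lborel (\<lambda>\<tau>. complex_of_real ((norm (strong_fourier M h \<tau>))\<^sup>2))
      (complex_of_real (2 * pi * (LINT t|M. (norm (h t))\<^sup>2)))"
    by simp
  from has_bochner_integral_Re[OF this] show ?thesis
    unfolding M_def by simp
qed

context
  fixes g :: "real \<Rightarrow> 'v::chilbert_space"
  assumes g: "strongly_integrable (lebesgue_on S) g"
    and g2: "integrable (lebesgue_on S) (\<lambda>t. (norm (g t))\<^sup>2)"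
begin

lemma simple_function_approximation_L1_L2:
  obtains h where "\<And>n. simple_function (lebesgue_on S) (h n)"
    "\<And>n. integrable (lebesgue_on S) (\<lambda>t. norm (h n t))"
    "\<And>n. integrable (lebesgue_on S) (\<lambda>t. (norm (g t - h n t))\<^sup>2)"
    "(\<lambda>n. LINT t|lebesgue_on S. (norm (h n t))\<^sup>2) \<longlonglongrightarrow> (LINT t|lebesgue_on S. (norm (g t))\<^sup>2)"
    "(\<lambda>n. LINT t|lebesgue_on S. (norm (g t - h n t))\<^sup>2) \<longlonglongrightarrow> 0"
    "\<And>\<tau>. (\<lambda>n. strong_fourier (lebesgue_on S) (h n) \<tau>) \<longlonglongrightarrow> strong_fourier (lebesgue_on S) g \<tau>"
proof -
  have sg: "strongly_measurable (lebesgue_on S) g" and ig: "integrable (lebesgue_on S) (\<lambda>t. norm (g t))"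
    using g by (auto simp: strongly_integrable_def)
  obtain h where h: "\<And>n. simple_function (lebesgue_on S) (h n)" "\<And>n x. norm (h n x) \<le> 2 * norm (g x)"
    "AE x in lebesgue_on S. (\<lambda>n. h n x) \<longlonglongrightarrow> g x"
    using dominated_simple_approximation[OF sg] by blast
  note sm = h(1)[THEN strongly_measurable_simple_function]
  note L1 = norm_power_dominated_convergence[OF sg sm h(2,3), where p = 1, unfolded power_one_right,
      OF ig zero_less_one]
  note L2 = norm_power_dominated_convergence[OF sg sm h(2,3) g2 zero_less_numeral]
  have hi: "strongly_integrable (lebesgue_on S) (h n)" for n
    using sm L1(1) by (simp add: strongly_integrable_def)
  have "(\<lambda>n. strong_fourier (lebesgue_on S) (h n) \<tau>) \<longlonglongrightarrow> strong_fourier (lebesgue_on S) g \<tau>" for \<tau>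
  proof (rule LIM_zero_cancel, rule Lim_null_comparison[OF _ L1(4)], rule always_eventually, rule allI)
    fix n
    show "norm (strong_fourier (lebesgue_on S) (h n) \<tau> - strong_fourier (lebesgue_on S) g \<tau>)
        \<le> (LINT t|lebesgue_on S. norm (g t - h n t))"
      using norm_strong_fourier_le[OF strongly_integrable_diff[OF g hi[of n]], of \<tau>]
      by (simp add: strong_fourier_diff[OF g hi] norm_minus_commute)
  qed
  then show thesis
    by (rule that[OF h(1) L1(1) L2(2-4)])
qed

text \<open>
  The transforms of the approximating simple functions converge pointwise, so Fatou's lemma gives
  one inequality.
\<close>

lemma Plancherel_le:
  shows integrable_norm_strong_fourier_square:
      "integrable lborel (\<lambda>\<tau>. (norm (strong_fourier (lebesgue_on S) g \<tau>))\<^sup>2)"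
    and integral_norm_strong_fourier_square_le:
      "(LINT \<tau>|lborel. (norm (strong_fourier (lebesgue_on S) g \<tau>))\<^sup>2)
        \<le> 2 * pi * (LINT t|lebesgue_on S. (norm (g t))\<^sup>2)"
proof -
  obtain h where h: "\<And>n. simple_function (lebesgue_on S) (h n)"
    "\<And>n. integrable (lebesgue_on S) (\<lambda>t. norm (h n t))"
    and d2: "\<And>n. integrable (lebesgue_on S) (\<lambda>t. (norm (g t - h n t))\<^sup>2)"
    and lim2: "(\<lambda>n. LINT t|lebesgue_on S. (norm (h n t))\<^sup>2) \<longlonglongrightarrow> (LINT t|lebesgue_on S. (norm (g t))\<^sup>2)"
      "(\<lambda>n. LINT t|lebesgue_on S. (norm (g t - h n t))\<^sup>2) \<longlonglongrightarrow> 0"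
    and lim: "\<And>\<tau>. (\<lambda>n. strong_fourier (lebesgue_on S) (h n) \<tau>) \<longlonglongrightarrow> strong_fourier (lebesgue_on S) g \<tau>"
    by (rule simple_function_approximation_L1_L2) (rule that)
  let ?G = "\<lambda>\<tau>. (norm (strong_fourier (lebesgue_on S) g \<tau>))\<^sup>2"
  let ?H = "\<lambda>n \<tau>. (norm (strong_fourier (lebesgue_on S) (h n) \<tau>))\<^sup>2"
  note PH = Plancherel_simple_function[OF h(1,2)]
  have H [measurable]: "?H n \<in> borel_measurable borel" for n
    using has_bochner_integral_implies_finite_norm PH[of n]
    by (auto simp: has_bochner_integral_iff dest: borel_measurable_integrable)
  have HG: "(\<lambda>n. ?H n \<tau>) \<longlonglongrightarrow> ?G \<tau>" for \<tau>
    by (intro tendsto_intros lim)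
  have G [measurable]: "?G \<in> borel_measurable borel"
    by (rule borel_measurable_LIMSEQ_real[OF HG H])
  have "(\<integral>\<^sup>+\<tau>. ennreal (?G \<tau>) \<partial>lborel) = (\<integral>\<^sup>+\<tau>. liminf (\<lambda>n. ennreal (?H n \<tau>)) \<partial>lborel)"
    by (intro nn_integral_cong lim_imp_Liminf[symmetric] tendsto_ennrealI HG) simp
  also have "\<dots> \<le> liminf (\<lambda>n. \<integral>\<^sup>+\<tau>. ennreal (?H n \<tau>) \<partial>lborel)"
    by (rule nn_integral_liminf) measurable
  also have "(\<lambda>n. \<integral>\<^sup>+\<tau>. ennreal (?H n \<tau>) \<partial>lborel) =
      (\<lambda>n. ennreal (2 * pi * (LINT t|lebesgue_on S. (norm (h n t))\<^sup>2)))"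
    using PH by (auto simp: has_bochner_integral_iff nn_integral_eq_integral)
  also have "liminf \<dots> = ennreal (2 * pi * (LINT t|lebesgue_on S. (norm (g t))\<^sup>2))"
    by (intro lim_imp_Liminf tendsto_ennrealI tendsto_mult tendsto_const lim2(1)) simp
  finally have le: "(\<integral>\<^sup>+\<tau>. ennreal (?G \<tau>) \<partial>lborel) \<le> ennreal (2 * pi * (LINT t|lebesgue_on S. (norm (g t))\<^sup>2))" .
  show int: "integrable lborel ?G"
    by (rule integrableI_bounded) (use le in \<open>auto simp: less_top[symmetric] top_unique\<close>)
  show "(LINT \<tau>|lborel. ?G \<tau>) \<le> 2 * pi * (LINT t|lebesgue_on S. (norm (g t))\<^sup>2)"
    using le by (subst (asm) nn_integral_eq_integral[OF int]) (auto simp: ennreal_le_iff)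
qed

end

text \<open>
  The inequality just proved also applies to \<open>g - h n\<close> and shows that the transform of \<open>h n\<close>
  approaches that of \<open>g\<close> in \<open>L\<^sup>2\<close>. Since equality holds for \<open>h n\<close>, it passes to the limit. Instead
  of the triangle inequality in \<open>L\<^sup>2\<close> the proof uses \<open>(x + y)\<^sup>2 \<le> (1 + \<delta>) x\<^sup>2 + (1 + 1 / \<delta>) y\<^sup>2\<close>,
  which can be integrated directly.
\<close>

theorem Plancherel:
  fixes g :: "real \<Rightarrow> 'v::chilbert_space"
  assumes g: "strongly_integrable (lebesgue_on S) g"
    and g2: "integrable (lebesgue_on S) (\<lambda>t. (norm (g t))\<^sup>2)"
  shows "has_bochner_integral lborel (\<lambda>\<tau>. (norm (strong_fourier (lebesgue_on S) g \<tau>))\<^sup>2)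
    (2 * pi * (LINT t|lebesgue_on S. (norm (g t))\<^sup>2))"
proof -
  obtain h where h: "\<And>n. simple_function (lebesgue_on S) (h n)"
    "\<And>n. integrable (lebesgue_on S) (\<lambda>t. norm (h n t))"
    and d2: "\<And>n. integrable (lebesgue_on S) (\<lambda>t. (norm (g t - h n t))\<^sup>2)"
    and lim2: "(\<lambda>n. LINT t|lebesgue_on S. (norm (h n t))\<^sup>2) \<longlonglongrightarrow> (LINT t|lebesgue_on S. (norm (g t))\<^sup>2)"
      "(\<lambda>n. LINT t|lebesgue_on S. (norm (g t - h n t))\<^sup>2) \<longlonglongrightarrow> 0"
    and lim: "\<And>\<tau>. (\<lambda>n. strong_fourier (lebesgue_on S) (h n) \<tau>) \<longlonglongrightarrow> strong_fourier (lebesgue_on S) g \<tau>"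
    by (rule simple_function_approximation_L1_L2[OF g g2]) (rule that)
  have hi: "strongly_integrable (lebesgue_on S) (h n)" for n
    using h by (simp add: strongly_integrable_def strongly_measurable_simple_function)
  let ?T = "strong_fourier (lebesgue_on S)"
  define I where "I = (LINT \<tau>|lborel. (norm (?T g \<tau>))\<^sup>2)"
  define J where "J = 2 * pi * (LINT t|lebesgue_on S. (norm (g t))\<^sup>2)"
  note intG = integrable_norm_strong_fourier_square[OF g g2]
  have I0: "I \<ge> 0"
    by (simp add: I_def)
  have delta: "J \<le> (1 + \<delta>) * I" if \<delta>: "\<delta> > 0" for \<delta>
  proof (rule LIMSEQ_le)
    show "(\<lambda>n. 2 * pi * (LINT t|lebesgue_on S. (norm (h n t))\<^sup>2)) \<longlonglongrightarrow> J"
      unfolding J_def by (intro tendsto_intros lim2)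
    have "(\<lambda>n. (1 + \<delta>) * I + (1 + 1 / \<delta>) * (2 * pi * (LINT t|lebesgue_on S. (norm (g t - h n t))\<^sup>2)))
        \<longlonglongrightarrow> (1 + \<delta>) * I + (1 + 1 / \<delta>) * (2 * pi * 0)"
      by (intro tendsto_intros lim2)
    then show "(\<lambda>n. (1 + \<delta>) * I + (1 + 1 / \<delta>) * (2 * pi * (LINT t|lebesgue_on S. (norm (g t - h n t))\<^sup>2)))
        \<longlonglongrightarrow> (1 + \<delta>) * I"
      by simp
    have "2 * pi * (LINT t|lebesgue_on S. (norm (h n t))\<^sup>2) \<le>
        (1 + \<delta>) * I + (1 + 1 / \<delta>) * (2 * pi * (LINT t|lebesgue_on S. (norm (g t - h n t))\<^sup>2))" for n
    proof -
      note D = strongly_integrable_diff[OF g hi[of n]]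
      note intD = integrable_norm_strong_fourier_square[OF D d2]
      have pointwise: "(norm (?T (h n) \<tau>))\<^sup>2 \<le>
          (1 + \<delta>) * (norm (?T g \<tau>))\<^sup>2 + (1 + 1 / \<delta>) * (norm (?T (\<lambda>t. g t - h n t) \<tau>))\<^sup>2" for \<tau>
      proof -
        define x where "x = norm (?T g \<tau>)"
        define y where "y = norm (?T (\<lambda>t. g t - h n t) \<tau>)"
        have "norm (?T (h n) \<tau>) \<le> x + y"
          using norm_triangle_ineq4[of "?T g \<tau>" "?T g \<tau> - ?T (h n) \<tau>"]
          by (simp add: x_def y_def strong_fourier_diff[OF g hi])
        then have "(norm (?T (h n) \<tau>))\<^sup>2 \<le> (x + y)\<^sup>2"
          by (intro power_mono) auto
        also have "\<dots> \<le> (1 + \<delta>) * x\<^sup>2 + (1 + 1 / \<delta>) * y\<^sup>2"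
        proof -
          have "0 \<le> (\<delta> * x - y)\<^sup>2 / \<delta>"
            using \<delta> by simp
          also have "\<dots> = \<delta> * x\<^sup>2 - 2 * x * y + y\<^sup>2 / \<delta>"
            using \<delta> by (simp add: field_simps power2_eq_square)
          finally show ?thesis
            by (simp add: power2_sum algebra_simps)
        qed
        finally show ?thesis
          by (simp add: x_def y_def)
      qed
      have "2 * pi * (LINT t|lebesgue_on S. (norm (h n t))\<^sup>2) = (LINT \<tau>|lborel. (norm (?T (h n) \<tau>))\<^sup>2)"
        by (rule has_bochner_integral_integral_eq[OF Plancherel_simple_function[OF h], symmetric])
      also have "\<dots> \<le> (LINT \<tau>|lborel. (1 + \<delta>) * (norm (?T g \<tau>))\<^sup>2 +
          (1 + 1 / \<delta>) * (norm (?T (\<lambda>t. g t - h n t) \<tau>))\<^sup>2)"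
        using intG intD pointwise \<delta>
        by (intro integral_mono') (auto intro!: add_nonneg_nonneg mult_nonneg_nonneg)
      also have "\<dots> = (1 + \<delta>) * I + (1 + 1 / \<delta>) * (LINT \<tau>|lborel. (norm (?T (\<lambda>t. g t - h n t) \<tau>))\<^sup>2)"
        using intG intD by (simp add: I_def)
      also have "\<dots> \<le> (1 + \<delta>) * I + (1 + 1 / \<delta>) * (2 * pi * (LINT t|lebesgue_on S. (norm (g t - h n t))\<^sup>2))"
        using \<delta> by (intro add_left_mono mult_left_mono integral_norm_strong_fourier_square_le[OF D d2]) auto
      finally show ?thesis .
    qed
    then show "\<exists>N. \<forall>n\<ge>N. 2 * pi * (LINT t|lebesgue_on S. (norm (h n t))\<^sup>2) \<le>
        (1 + \<delta>) * I + (1 + 1 / \<delta>) * (2 * pi * (LINT t|lebesgue_on S. (norm (g t - h n t))\<^sup>2))"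
      by blast
  qed
  have "J \<le> I"
  proof (rule field_le_epsilon)
    fix e :: real assume "e > 0"
    with delta[of "e / (I + 1)"] I0 have "J \<le> I + e * (I / (I + 1))"
      by (simp add: field_simps)
    also have "e * (I / (I + 1)) \<le> e * 1"
      using \<open>e > 0\<close> I0 by (intro mult_left_mono) auto
    finally show "J \<le> I + e"
      by simp
  qed
  moreover have "I \<le> J"
    unfolding I_def J_def by (rule integral_norm_strong_fourier_square_le[OF g g2])
  ultimately show ?thesis
    using intG by (simp add: has_bochner_integral_iff I_def J_def)
qed

end

section \<open>The Laplace transform on a weighted \<open>L\<^sup>2\<close> space\<close>

lemma exp_square_mult: "(exp (a * t))\<^sup>2 = exp (2 * a * t :: real)"
  by (simp add: mult.assoc exp_double)

text \<open>
  Half of the decay rate absorbs the power: \<open>\<eta> * t \<le> exp (\<eta> * t)\<close> raised to the power \<open>k\<close>, with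
  \<open>\<eta>\<close> so small that \<open>k * \<eta> \<le> \<delta> / 2\<close> (and positive also for \<open>k = 0\<close>).
\<close>

lemma integrable_power_exp:
  assumes \<delta>: "\<delta> > (0::real)"
  shows "integrable (lebesgue_on {0<..}) (\<lambda>t. t ^ k * exp (- \<delta> * t))"
proof -
  define \<eta> where "\<eta> = \<delta> / (2 * real (Suc k))"
  have \<eta>: "\<eta> > 0"
    using \<delta> by (simp add: \<eta>_def)
  have "(\<lambda>t. exp (- (\<delta> / 2) * t)) absolutely_integrable_on {0..}"
    using \<delta> by (intro nonnegative_absolutely_integrable_1 integrable_on_exp_minus_to_infinity) auto
  then have "(\<lambda>t. exp (- (\<delta> / 2) * t)) absolutely_integrable_on {0<..}"
    by (rule set_integrable_subset) auto
  then have e: "integrable (lebesgue_on {0<..}) (\<lambda>t. exp (- (\<delta> / 2) * t))"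
    by (simp add: integrable_restrict_space set_integrable_def)
  show ?thesis
  proof (rule Bochner_Integration.integrable_bound)
    show "integrable (lebesgue_on {0<..}) (\<lambda>t. exp (- (\<delta> / 2) * t) / \<eta> ^ k)"
      by (rule integrable_divide[OF e])
    show "(\<lambda>t. t ^ k * exp (- \<delta> * t)) \<in> borel_measurable (lebesgue_on {0<..})"
      by (rule borel_measurable_lebesgue_on) measurable
    show "AE t in lebesgue_on {0<..}. norm (t ^ k * exp (- \<delta> * t)) \<le> norm (exp (- (\<delta> / 2) * t) / \<eta> ^ k)"
      using AE_space
    proof eventually_elim
      fix t assume "t \<in> space (lebesgue_on {0::real<..})"
      then have t: "t > 0"
        by simp
      have "\<eta> * t \<le> exp (\<eta> * t)"
        using exp_ge_add_one_self[of "\<eta> * t"] by linarith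
      then have "(\<eta> * t) ^ k \<le> exp (\<eta> * t) ^ k"
        using \<eta> t by (intro power_mono) auto
      also have "\<dots> = exp (real k * (\<eta> * t))"
        by (simp add: exp_of_nat_mult)
      also have "real k * (\<eta> * t) \<le> \<delta> / 2 * t"
      proof -
        have "real k * \<eta> \<le> \<delta> / 2"
          using \<delta> by (simp add: \<eta>_def field_simps)
        then show ?thesis
          using t by (simp add: mult.assoc[symmetric])
      qed
      finally have "\<eta> ^ k * t ^ k \<le> exp (\<delta> / 2 * t)"
        by (simp add: power_mult_distrib)
      then have "t ^ k \<le> exp (\<delta> / 2 * t) / \<eta> ^ k"
        using \<eta> by (simp add: field_simps)
      then have "t ^ k * exp (- \<delta> * t) \<le> exp (\<delta> / 2 * t) / \<eta> ^ k * exp (- \<delta> * t)"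
        by (rule mult_right_mono) simp
      also have "\<dots> = exp (- (\<delta> / 2) * t) / \<eta> ^ k"
        by (simp flip: exp_add)
      finally show "norm (t ^ k * exp (- \<delta> * t)) \<le> norm (exp (- (\<delta> / 2) * t) / \<eta> ^ k)"
        using t \<eta> by simp
    qed
  qed
qed

text \<open>
  A second-order Taylor estimate for the exponential. The factor \<open>exp (norm (w - s) * t)\<close> in the remainder
  costs only \<open>r\<close> in the decay rate, so for small \<open>r\<close> the bound can still be integrated against functions of
  smaller exponential growth; the factor \<open>norm (w - s)\<close> makes the difference quotient converge.
\<close>

lemma exp_difference_quotient_bound:
  fixes s w :: complex and t r :: real
  assumes "w \<noteq> s" "norm (w - s) \<le> r" "t > 0"
  shows "norm (1 / (w - s) * (exp (- w * of_real t) - exp (- s * of_real t)) - (- of_real t * exp (- s * of_real t)))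
    \<le> norm (w - s) * (t ^ 2 * exp (- (Re s - r) * t))"
proof -
  define z where "z = - ((w - s) * of_real t)"
  have nz: "norm z = norm (w - s) * t"
    using assms by (simp add: z_def norm_mult)
  have "1 / (w - s) * (exp (- w * of_real t) - exp (- s * of_real t)) - (- of_real t * exp (- s * of_real t)) =
      exp (- s * of_real t) / (w - s) * (exp z - (1 + z))"
  proof -
    have "exp (- w * of_real t) = exp (- s * of_real t) * exp z"
      by (simp add: z_def algebra_simps flip: exp_add)
    then show ?thesis
      using assms by (simp add: z_def field_simps)
  qed
  also have "norm \<dots> = exp (- Re s * t) / norm (w - s) * norm (exp z - (1 + z))"
    by (simp add: norm_mult norm_divide)
  also have "\<dots> \<le> exp (- Re s * t) / norm (w - s) * (exp (norm z) * (norm z)\<^sup>2)"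
    using Taylor_exp_field[of z 1] by (intro mult_left_mono) (simp_all add: power2_eq_square)
  also have "\<dots> = norm (w - s) * (t ^ 2 * exp (norm z - Re s * t))"
    using assms by (simp add: nz power2_eq_square exp_diff exp_minus field_simps)
  also have "\<dots> \<le> norm (w - s) * (t ^ 2 * exp (- (Re s - r) * t))"
  proof -
    have "norm z \<le> r * t"
      unfolding nz using assms by (intro mult_right_mono) auto
    then show ?thesis
      by (intro mult_left_mono) (auto simp: algebra_simps)
  qed
  finally show ?thesis .
qed

context
  fixes \<alpha> :: real and f :: "real \<Rightarrow> 'v::chilbert_space"
  assumes f: "f \<in> weighted_L2 \<alpha>"
begin

interpretation complete_measure "lebesgue_on {0::real<..}"
  by (rule complete_measure_lebesgue_on) simp

lemma weighted_L2_strongly_measurable: "strongly_measurable (lebesgue_on {0<..}) f"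
  and weighted_L2_integrable: "integrable (lebesgue_on {0<..}) (\<lambda>t. (norm (f t))\<^sup>2 * exp (- 2 * \<alpha> * t))"
  using f by (auto simp: weighted_L2_def)

lemma borel_measurable_mult_norm_weighted_L2:
  assumes "\<phi> \<in> borel_measurable borel"
  shows "(\<lambda>t. \<phi> t * norm (f t) ^ n) \<in> borel_measurable (lebesgue_on {0<..})"
  using borel_measurable_lebesgue_on[OF assms] norm_measurable[OF weighted_L2_strongly_measurable]
  by measurable

text \<open>
  Split \<open>exp (- \<sigma> * t)\<close> into \<open>exp (- (\<sigma> - \<alpha>) * t)\<close>, which together with the power is square
  integrable, and \<open>exp (- \<alpha> * t)\<close>, which belongs to \<open>f\<close>. The exponents \<open>k = 0, 1, 2\<close> serve the
  transform itself, its derivative and the remainder of the difference quotient.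
\<close>

lemma weighted_L2_integrable_power_exp:
  assumes \<sigma>: "\<sigma> > \<alpha>"
  shows "integrable (lebesgue_on {0<..}) (\<lambda>t. t ^ k * exp (- \<sigma> * t) * norm (f t))"
proof (rule Bochner_Integration.integrable_bound)
  show "integrable (lebesgue_on {0<..})
      (\<lambda>t. t ^ (2 * k) * exp (- (2 * (\<sigma> - \<alpha>)) * t) + (norm (f t))\<^sup>2 * exp (- 2 * \<alpha> * t))"
    using \<sigma> by (intro Bochner_Integration.integrable_add integrable_power_exp weighted_L2_integrable) simp
  show "(\<lambda>t. t ^ k * exp (- \<sigma> * t) * norm (f t)) \<in> borel_measurable (lebesgue_on {0<..})"
    using borel_measurable_mult_norm_weighted_L2[of "\<lambda>t. t ^ k * exp (- \<sigma> * t)" 1] by simp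
  show "AE t in lebesgue_on {0<..}. norm (t ^ k * exp (- \<sigma> * t) * norm (f t))
      \<le> norm (t ^ (2 * k) * exp (- (2 * (\<sigma> - \<alpha>)) * t) + (norm (f t))\<^sup>2 * exp (- 2 * \<alpha> * t))"
    using AE_space
  proof eventually_elim
    fix t assume "t \<in> space (lebesgue_on {0::real<..})"
    then have t: "t > 0"
      by simp
    define x where "x = t ^ k * exp (- (\<sigma> - \<alpha>) * t)"
    define y where "y = norm (f t) * exp (- \<alpha> * t)"
    have nonneg: "x \<ge> 0" "y \<ge> 0"
      using t by (auto simp: x_def y_def)
    have "x * y \<le> 2 * x * y"
      using nonneg by simp
    also have "\<dots> \<le> x\<^sup>2 + y\<^sup>2"
      by (rule sum_squares_bound)
    finally have "x * y \<le> x\<^sup>2 + y\<^sup>2" .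
    moreover have "x * y = t ^ k * exp (- \<sigma> * t) * norm (f t)"
      by (simp add: x_def y_def algebra_simps flip: exp_add)
    moreover have "x\<^sup>2 = t ^ (2 * k) * exp (- (2 * (\<sigma> - \<alpha>)) * t)"
      unfolding x_def power_mult_distrib power_even_eq exp_square_mult by simp
    moreover have "y\<^sup>2 = (norm (f t))\<^sup>2 * exp (- 2 * \<alpha> * t)"
      unfolding y_def power_mult_distrib exp_square_mult by simp
    ultimately show "norm (t ^ k * exp (- \<sigma> * t) * norm (f t))
      \<le> norm (t ^ (2 * k) * exp (- (2 * (\<sigma> - \<alpha>)) * t) + (norm (f t))\<^sup>2 * exp (- 2 * \<alpha> * t))"
      using nonneg by (metis abs_of_nonneg mult_nonneg_nonneg order_trans real_norm_def)
  qed
qed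

lemma weighted_L2_strongly_integrable:
  assumes \<sigma>: "\<sigma> > \<alpha>" and \<phi>: "\<phi> \<in> borel_measurable borel"
    and bound: "\<And>t. t > 0 \<Longrightarrow> cmod (\<phi> t) \<le> C * (t ^ k * exp (- \<sigma> * t))"
  shows "strongly_integrable (lebesgue_on {0<..}) (\<lambda>t. \<phi> t *\<^sub>C f t)"
    and "norm (strong_integral (lebesgue_on {0<..}) (\<lambda>t. \<phi> t *\<^sub>C f t))
      \<le> C * (LINT t|lebesgue_on {0<..}. t ^ k * exp (- \<sigma> * t) * norm (f t))"
proof -
  have int: "integrable (lebesgue_on {0<..}) (\<lambda>t. C * (t ^ k * exp (- \<sigma> * t) * norm (f t)))"
    by (intro integrable_mult_right weighted_L2_integrable_power_exp \<sigma>)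
  have le: "norm (\<phi> t *\<^sub>C f t) \<le> C * (t ^ k * exp (- \<sigma> * t) * norm (f t))" if "t > 0" for t
    using mult_right_mono[OF bound[OF that] norm_ge_zero[of "f t"]] by (simp add: norm_scaleC mult.assoc)
  show 1: "strongly_integrable (lebesgue_on {0<..}) (\<lambda>t. \<phi> t *\<^sub>C f t)"
    by (rule strongly_integrable_bound[OF strongly_measurable_scaleC int])
      (use \<phi> le in \<open>auto intro: borel_measurable_lebesgue_on weighted_L2_strongly_measurable\<close>)
  have "norm (strong_integral (lebesgue_on {0<..}) (\<lambda>t. \<phi> t *\<^sub>C f t))
      \<le> (LINT t|lebesgue_on {0<..}. norm (\<phi> t *\<^sub>C f t))"
    by (rule norm_strong_integral_le[OF 1])
  also have "\<dots> \<le> (LINT t|lebesgue_on {0<..}. C * (t ^ k * exp (- \<sigma> * t) * norm (f t)))"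
    using 1 int le by (intro integral_mono) (auto simp: strongly_integrable_def)
  finally show "norm (strong_integral (lebesgue_on {0<..}) (\<lambda>t. \<phi> t *\<^sub>C f t))
      \<le> C * (LINT t|lebesgue_on {0<..}. t ^ k * exp (- \<sigma> * t) * norm (f t))"
    by simp
qed

lemma laplace_strongly_integrable:
  assumes "Re s > \<alpha>"
  shows "strongly_integrable (lebesgue_on {0<..}) (\<lambda>t. exp (- s * complex_of_real t) *\<^sub>C f t)"
  by (rule weighted_L2_strongly_integrable(1)[OF assms, where C = 1 and k = 0]) simp_all

text \<open>
  The derivative is the transform of \<open>- t * f t\<close>. Choosing \<open>r\<close> as half the distance from \<open>s\<close> to
  the boundary line leaves the decay rate \<open>Re s - r\<close> above \<open>\<alpha>\<close>.
\<close>

lemma vector_holomorphic_on_laplace_transform: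
  "vector_holomorphic_on (laplace_transform f) {s. Re s > \<alpha>}"
  unfolding vector_holomorphic_on_def
proof (intro ballI)
  fix s assume "s \<in> {s. Re s > \<alpha>}"
  then have s: "Re s > \<alpha>"
    by simp
  define r where "r = (Re s - \<alpha>) / 2"
  have r: "r > 0" "Re s - r > \<alpha>"
    using s by (auto simp: r_def field_simps)
  define D where "D = strong_integral (lebesgue_on {0<..}) (\<lambda>t. (- complex_of_real t * exp (- s * complex_of_real t)) *\<^sub>C f t)"
  define K where "K = (LINT t|lebesgue_on {0<..}. t ^ 2 * exp (- (Re s - r) * t) * norm (f t))"
  have D_int: "strongly_integrable (lebesgue_on {0<..}) (\<lambda>t. (- complex_of_real t * exp (- s * complex_of_real t)) *\<^sub>C f t)"
    by (rule weighted_L2_strongly_integrable(1)[OF s, where C = 1 and k = 1]) (simp_all add: norm_mult)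
  have bound: "norm ((1 / (w - s)) *\<^sub>C (laplace_transform f w - laplace_transform f s) - D) \<le> norm (w - s) * K"
    if w: "w \<noteq> s" "norm (w - s) < r" for w
  proof -
    have "\<bar>Re (w - s)\<bar> < r"
      using abs_Re_le_cmod[of "w - s"] w by linarith
    then have "Re w > \<alpha>"
      using r by simp
    note W = laplace_strongly_integrable[OF this] and S = laplace_strongly_integrable[OF s]
    have quotient: "strongly_integrable (lebesgue_on {0<..})
        (\<lambda>t. (1 / (w - s)) *\<^sub>C (exp (- w * complex_of_real t) *\<^sub>C f t - exp (- s * complex_of_real t) *\<^sub>C f t))"
      using strongly_integrable_diff[OF W S]
      by (simp add: strongly_integrable_def strongly_measurable_scaleC norm_scaleC)
    have "(1 / (w - s)) *\<^sub>C (laplace_transform f w - laplace_transform f s) - D =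
        strong_integral (lebesgue_on {0<..})
          (\<lambda>t. (1 / (w - s)) *\<^sub>C (exp (- w * complex_of_real t) *\<^sub>C f t - exp (- s * complex_of_real t) *\<^sub>C f t)
            - (- complex_of_real t * exp (- s * complex_of_real t)) *\<^sub>C f t)"
      unfolding strong_integral_diff[OF quotient D_int] strong_integral_scaleC[OF strongly_integrable_diff[OF W S]]
        strong_integral_diff[OF W S] laplace_transform_def D_def ..
    also have "\<dots> = strong_integral (lebesgue_on {0<..})
        (\<lambda>t. (1 / (w - s) * (exp (- w * complex_of_real t) - exp (- s * complex_of_real t)) -
          (- complex_of_real t * exp (- s * complex_of_real t))) *\<^sub>C f t)"
      unfolding scaleC_diff_left[symmetric] scaleC_scaleC ..
    also have "norm \<dots> \<le> norm (w - s) * K"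
      unfolding K_def
    proof (rule weighted_L2_strongly_integrable(2)[OF r(2)])
      show "(\<lambda>t. 1 / (w - s) * (exp (- w * complex_of_real t) - exp (- s * complex_of_real t)) -
          (- complex_of_real t * exp (- s * complex_of_real t))) \<in> borel_measurable borel"
        by measurable
    qed (rule exp_difference_quotient_bound[OF w(1) less_imp_le[OF w(2)]])
    finally show ?thesis .
  qed
  have "((\<lambda>w. (1 / (w - s)) *\<^sub>C (laplace_transform f w - laplace_transform f s) - D) \<longlongrightarrow> 0)
      (at s within {s. Re s > \<alpha>})"
  proof (rule Lim_null_comparison)
    show "eventually (\<lambda>w. norm ((1 / (w - s)) *\<^sub>C (laplace_transform f w - laplace_transform f s) - D) \<le> norm (w - s) * K)
        (at s within {s. Re s > \<alpha>})"
      unfolding eventually_at using bound r(1) by (intro exI[of _ r]) (auto simp: dist_norm)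
    have "((\<lambda>w. norm (w - s) * K) \<longlongrightarrow> norm (s - s) * K) (at s within {s. Re s > \<alpha>})"
      by (intro tendsto_intros)
    then show "((\<lambda>w. norm (w - s) * K) \<longlongrightarrow> 0) (at s within {s. Re s > \<alpha>})"
      by simp
  qed
  then show "\<exists>D. ((\<lambda>w. (1 / (w - s)) *\<^sub>C (laplace_transform f w - laplace_transform f s)) \<longlongrightarrow> D)
      (at s within {s. Re s > \<alpha>})"
    by (intro exI[of _ D]) (rule LIM_zero_cancel)
qed

lemma weighted_L2_integrable_of_ge:
  assumes "\<sigma> \<ge> \<alpha>"
  shows "integrable (lebesgue_on {0<..}) (\<lambda>t. (norm (f t))\<^sup>2 * exp (- 2 * \<sigma> * t))"
    and "(LINT t|lebesgue_on {0<..}. (norm (f t))\<^sup>2 * exp (- 2 * \<sigma> * t))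
      \<le> (LINT t|lebesgue_on {0<..}. (norm (f t))\<^sup>2 * exp (- 2 * \<alpha> * t))"
proof -
  have le: "(norm (f t))\<^sup>2 * exp (- 2 * \<sigma> * t) \<le> (norm (f t))\<^sup>2 * exp (- 2 * \<alpha> * t)" if "t > 0" for t
    using assms that by (intro mult_left_mono) auto
  show 1: "integrable (lebesgue_on {0<..}) (\<lambda>t. (norm (f t))\<^sup>2 * exp (- 2 * \<sigma> * t))"
  proof (rule Bochner_Integration.integrable_bound[OF weighted_L2_integrable])
    show "(\<lambda>t. (norm (f t))\<^sup>2 * exp (- 2 * \<sigma> * t)) \<in> borel_measurable (lebesgue_on {0<..})"
      using borel_measurable_mult_norm_weighted_L2[of "\<lambda>t. exp (- 2 * \<sigma> * t)" 2] by (simp add: mult.commute)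
    show "AE t in lebesgue_on {0<..}. norm ((norm (f t))\<^sup>2 * exp (- 2 * \<sigma> * t))
        \<le> norm ((norm (f t))\<^sup>2 * exp (- 2 * \<alpha> * t))"
      using AE_space by eventually_elim (use le in auto)
  qed
  show "(LINT t|lebesgue_on {0<..}. (norm (f t))\<^sup>2 * exp (- 2 * \<sigma> * t))
      \<le> (LINT t|lebesgue_on {0<..}. (norm (f t))\<^sup>2 * exp (- 2 * \<alpha> * t))"
    by (rule integral_mono[OF 1 weighted_L2_integrable]) (use le in auto)
qed

text \<open>
  On the line with real part \<open>\<sigma>\<close> the Laplace transform of \<open>f\<close> is the Fourier transform of
  \<open>exp (- \<sigma> * t) * f t\<close>.
\<close>

lemma Plancherel_laplace_transform:
  assumes \<sigma>: "\<sigma> > \<alpha>"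
  shows "has_bochner_integral lebesgue (\<lambda>\<tau>. (norm (laplace_transform f (Complex \<sigma> \<tau>)))\<^sup>2)
    (2 * pi * (LINT t|lebesgue_on {0<..}. (norm (f t))\<^sup>2 * exp (- 2 * \<sigma> * t)))"
proof -
  define g where "g t = complex_of_real (exp (- \<sigma> * t)) *\<^sub>C f t" for t
  have g: "strongly_integrable (lebesgue_on {0<..}) g"
    unfolding g_def[abs_def]
    by (rule weighted_L2_strongly_integrable(1)[OF \<sigma>, where C = 1 and k = 0]) simp_all
  have norm_g: "(norm (g t))\<^sup>2 = (norm (f t))\<^sup>2 * exp (- 2 * \<sigma> * t)" for t
    unfolding g_def norm_scaleC norm_of_real abs_exp_cancel power_mult_distrib exp_square_mult by simp
  have "laplace_transform f (Complex \<sigma> \<tau>) = strong_fourier (lebesgue_on {0<..}) g \<tau>" for \<tau>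
  proof -
    have "exp (- Complex \<sigma> \<tau> * complex_of_real t) = iexp (- (\<tau> * t)) * complex_of_real (exp (- \<sigma> * t))" for t
    proof -
      have "- Complex \<sigma> \<tau> * complex_of_real t = \<i> * complex_of_real (- (\<tau> * t)) + complex_of_real (- \<sigma> * t)"
        by (simp add: Complex_eq algebra_simps)
      then show ?thesis
        by (simp only: exp_add exp_of_real)
    qed
    then show ?thesis
      unfolding laplace_transform_def strong_fourier_def g_def scaleC_scaleC by simp
  qed
  moreover have "has_bochner_integral lborel (\<lambda>\<tau>. (norm (strong_fourier (lebesgue_on {0<..}) g \<tau>))\<^sup>2)
      (2 * pi * (LINT t|lebesgue_on {0<..}. (norm (g t))\<^sup>2))"
    using weighted_L2_integrable_of_ge(1)[of \<sigma>] \<sigma> by (intro Plancherel g) (simp_all add: norm_g)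
  ultimately have "has_bochner_integral lborel (\<lambda>\<tau>. (norm (laplace_transform f (Complex \<sigma> \<tau>)))\<^sup>2)
      (2 * pi * (LINT t|lebesgue_on {0<..}. (norm (f t))\<^sup>2 * exp (- 2 * \<sigma> * t)))"
    by (simp add: norm_g)
  then show ?thesis
    unfolding has_bochner_integral_iff
    by (auto simp: integral_completion dest: borel_measurable_integrable intro: integrable_completion[THEN iffD2])
qed

lemma weighted_L2_norm_tendsto:
  "(\<lambda>n. LINT t|lebesgue_on {0<..}. (norm (f t))\<^sup>2 * exp (- 2 * (\<alpha> + inverse (real (Suc n))) * t))
    \<longlonglongrightarrow> (LINT t|lebesgue_on {0<..}. (norm (f t))\<^sup>2 * exp (- 2 * \<alpha> * t))"
proof (rule integral_dominated_convergence[OF _ _ weighted_L2_integrable])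
  let ?\<sigma> = "\<lambda>n. \<alpha> + inverse (real (Suc n))"
  show "(\<lambda>t. (norm (f t))\<^sup>2 * exp (- 2 * \<alpha> * t)) \<in> borel_measurable (lebesgue_on {0<..})"
    using weighted_L2_integrable by (rule borel_measurable_integrable)
  show "(\<lambda>t. (norm (f t))\<^sup>2 * exp (- 2 * ?\<sigma> n * t)) \<in> borel_measurable (lebesgue_on {0<..})" for n
    by (intro borel_measurable_integrable weighted_L2_integrable_of_ge) simp
  have "?\<sigma> \<longlonglongrightarrow> \<alpha> + 0"
    by (intro tendsto_intros LIMSEQ_inverse_real_of_nat)
  then show "AE t in lebesgue_on {0<..}. (\<lambda>n. (norm (f t))\<^sup>2 * exp (- 2 * ?\<sigma> n * t))
      \<longlonglongrightarrow> (norm (f t))\<^sup>2 * exp (- 2 * \<alpha> * t)"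
    by (intro AE_I2 tendsto_intros) simp
  show "AE t in lebesgue_on {0<..}. norm ((norm (f t))\<^sup>2 * exp (- 2 * ?\<sigma> n * t))
      \<le> (norm (f t))\<^sup>2 * exp (- 2 * \<alpha> * t)" for n
    using AE_space
  proof eventually_elim
    case (elim t)
    then have "0 \<le> inverse (real (Suc n)) * t"
      by simp
    then have "- 2 * ?\<sigma> n * t \<le> - 2 * \<alpha> * t"
      by (simp add: algebra_simps del: of_nat_Suc)
    then show ?case
      by (simp add: mult_left_mono del: of_nat_Suc)
  qed
qed

end

theorem corollary1:
  fixes \<alpha> :: real and f :: "real \<Rightarrow> 'v::chilbert_space"
  assumes "\<alpha> > 0" and "f \<in> weighted_L2 \<alpha>"
  shows "laplace_transform f \<in> hardy_H2 \<alpha> \<and>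
    weighted_L2_norm \<alpha> f = 1 / sqrt (2 * pi) * hardy_H2_norm \<alpha> (laplace_transform f)"
proof -
  note f = assms(2)
  define W where "W \<sigma> = (LINT t|lebesgue_on {0<..}. (norm (f t))\<^sup>2 * exp (- 2 * \<sigma> * t))" for \<sigma>
  define N where "N \<sigma> = sqrt (LINT \<tau>|lebesgue. (norm (laplace_transform f (Complex \<sigma> \<tau>)))\<^sup>2)" for \<sigma>
  have N: "N \<sigma> = sqrt (2 * pi * W \<sigma>)" if "\<sigma> > \<alpha>" for \<sigma>
    using has_bochner_integral_integral_eq[OF Plancherel_laplace_transform[OF f that]]
    by (simp add: N_def W_def)
  have N_le: "N \<sigma> \<le> sqrt (2 * pi * W \<alpha>)" if "\<sigma> \<in> {\<alpha><..}" for \<sigma>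
    using weighted_L2_integrable_of_ge(2)[OF f, of \<sigma>] that by (simp add: N W_def)
  have bdd: "bdd_above (N ` {\<alpha><..})"
    using N_le by (rule bdd_aboveI2)
  have hardy: "laplace_transform f \<in> hardy_H2 \<alpha>"
    using vector_holomorphic_on_laplace_transform[OF f] Plancherel_laplace_transform[OF f] bdd
    by (auto simp: hardy_H2_def has_bochner_integral_iff N_def)
  have "(SUP \<sigma>\<in>{\<alpha><..}. N \<sigma>) = sqrt (2 * pi * W \<alpha>)"
  proof (rule antisym)
    show "(SUP \<sigma>\<in>{\<alpha><..}. N \<sigma>) \<le> sqrt (2 * pi * W \<alpha>)"
      using N_le by (intro cSUP_least) auto
    have "(\<lambda>n. sqrt (2 * pi * W (\<alpha> + inverse (real (Suc n))))) \<longlonglongrightarrow> sqrt (2 * pi * W \<alpha>)"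
      unfolding W_def by (intro tendsto_intros weighted_L2_norm_tendsto f)
    moreover have "sqrt (2 * pi * W (\<alpha> + inverse (real (Suc n)))) \<le> (SUP \<sigma>\<in>{\<alpha><..}. N \<sigma>)" for n
      using cSUP_upper[OF _ bdd, of "\<alpha> + inverse (real (Suc n))"] N[of "\<alpha> + inverse (real (Suc n))"] by simp
    ultimately show "sqrt (2 * pi * W \<alpha>) \<le> (SUP \<sigma>\<in>{\<alpha><..}. N \<sigma>)"
      by (intro LIMSEQ_le_const2) auto
  qed
  then have "hardy_H2_norm \<alpha> (laplace_transform f) = sqrt (2 * pi) * weighted_L2_norm \<alpha> f"
    by (simp add: hardy_H2_norm_def weighted_L2_norm_def N_def W_def real_sqrt_mult)
  then have "weighted_L2_norm \<alpha> f = 1 / sqrt (2 * pi) * hardy_H2_norm \<alpha> (laplace_transform f)"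
    by simp
  with hardy show ?thesis
    by blast
qed

end
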